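(* Let $F:\mathcal{E}\to\mathcal{B}$ be a row-finite Kumjian-Pask fibration such that every slice category $\mathcal{B}/B$ is countable. Then $G_F$, with the topology induced by the basis $\{Z(\mu,\nu):(\mu,\nu)\text{ is a span in }\mathcal{E}\}$ (i.e. $\mu,\nu\in\mathcal{E}$ with $s(\mu)=s(\nu)$), is totally disconnected, locally compact and Hausdorff.
   Context: All categories are small and identified with their sets of morphisms. Composition is written anti-diagrammatically: for $\beta:C\to B$ and $\alpha:B\to A$ the composite is $\alpha\beta$; $r(\alpha)$ is the codomain and $s(\alpha)$ the domain of $\alpha$. For an object $X$ of $\mathcal{C}$, $X\mathcal{C}$ is the set of morphisms with codomain $X$. A functor $F:\mathcal{E}\to\mathcal{B}$ is a discrete Conduché fibration if for every morphism $\phi$ of $\mathcal{E}$ and every factorization $F(\phi)=\rho\lambda$ in $\mathcal{B}$ there is a unique factorization $\phi=\tilde\rho\tilde\lambda$ in $\mathcal{E}$ with $F(\tilde\rho)=\rho$, $F(\tilde\lambda)=\lambda$. $F$ is row-finite if for every object $X$ of $\mathcal{E}$ and every $b\in F(X)\mathcal{B}$ the set $\{\alpha\in X\mathcal{E}:F(\alpha)=b\}$ is finite. A category is right Ore if for every cospan $m,n$ (morphisms with common codomain) there are $p,q$ with $mp=nq$. It is strongly right Ore if it is right Ore and, for every cospan $m,n$ and all $p_1,p_2,q_1,q_2$ with $mp_i=nq_i$ ($i=1,2$), there exist $a,b$ with $p_1a=p_2b$ and $q_1a=q_2b$. The slice category $\mathcal{C}/X$ has as objects the elements of $X\mathcal{C}$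 and as morphisms the pairs $(\alpha,\gamma)$ with $\alpha\in X\mathcal{C}$, $r(\gamma)=s(\alpha)$; $(\alpha,\gamma)$ has range $\alpha$ and source $\alpha\gamma$, and $(\alpha,\gamma)(\alpha\gamma,\delta)=(\alpha,\gamma\delta)$. A functor $F:\mathcal{E}\to\mathcal{B}$ induces functors $F:\mathcal{E}/X\to\mathcal{B}/F(X)$. $F$ is locally split if for every object $X$ of $\mathcal{E}$ there is a functor $x:\mathcal{B}/F(X)\to\mathcal{E}/X$ with $F\circ x=\mathrm{Id}$. A Kumjian-Pask fibration is a locally split discrete Conduché fibration $F:\mathcal{E}\to\mathcal{B}$ with $\mathcal{B}$ strongly right Ore. An infinite path to an object $X$ of $\mathcal{E}$ is a functor $x:\mathcal{B}/F(X)\to\mathcal{E}/X$ with $F\circ x=\mathrm{Id}_{\mathcal{B}/F(X)}$; $Z(X)$ is the set of these (a path remembers its object $X=:r(x)$, so the $Z(X)$ are pairwise disjoint), and $F^\infty=\bigcup_X Z(X)$. For $a\in F(X)\mathcal{B}$, $x(a)\in X\mathcal{E}$ is the image of the object $a$; for a morphism $(a,b)$ of $\mathcal{B}/F(X)$ write $x(a,b)=(x_1(a,b),x_2(a,b))$, so $x_1(a,b)=x(a)$, $F(x_2(a,b))=b$ and $x(a)x_2(a,b)=x(ab)$. For a morphism $\mu$ of $\mathcal{E}$, $Z(\mu)=\{x\in Z(r(\mu)):x(F(\mu))=\mu\}$. For $\mu\in\mathcal{E}$, $\mathrm{res}_\mu:Z(\mu)\to Z(s(\mu))$ is defined by $\mathrm{res}_\mu(x)(a,b)=(x_2(F(\mu),a),x_2(F(\mu)a,b))$.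 It is a bijection, with inverse $\mathrm{ind}_\mu:Z(s(\mu))\to Z(\mu)$; $\mathrm{ind}_\mu(x)$ is the unique $y\in Z(\mu)$ with $y(F(\mu)a)=\mu\,x(a)$ for all $a\in F(s(\mu))\mathcal{B}$. Let $\mathcal{G}_F=\{(\mu,\nu,x)\in\mathcal{E}\times\mathcal{E}\times F^\infty: x\in Z(\nu),\ s(\mu)=s(\nu)\}$. Define $(\mu,\nu,x)\sim(\mu',\nu',x')$ iff (1) $x=x'$; (2) there is $\lambda\in\mathcal{E}$ with $x\in Z(\lambda)\subset Z(\nu)\cap Z(\nu')$ and $\mathrm{ind}_\mu\circ\mathrm{res}_\nu|_{Z(\lambda)}=\mathrm{ind}_{\mu'}\circ\mathrm{res}_{\nu'}|_{Z(\lambda)}$; (3) there are $a,b\in\mathcal{B}$ with $F(\mu)a=F(\mu')b$ and $F(\nu)a=F(\nu')b$. This is an equivalence relation; $G_F=\mathcal{G}_F/\sim$ and $[\mu,\nu,x]$ is the class of $(\mu,\nu,x)$. For $\mu,\nu\in\mathcal{E}$ with $s(\mu)=s(\nu)$, $Z(\mu,\nu)=\{[\mu,\nu,x]:x\in Z(\nu)\}\subset G_F$; these sets form a basis for a topology. *)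

theory Defs
  imports "HOL-Analysis.Analysis"
begin

section \<open>Small categories, identified with their sets of morphisms\<close>

text \<open>
  Objects are identified with their identity morphisms.  For morphisms with
  \<open>src C f = rng C g\<close>, the term \<open>cmp C f g\<close> is the composite "first \<open>g\<close>, then \<open>f\<close>",
  written \<open>f g\<close> in the comments below.
\<close>

record 'a cat =
  Mor :: "'a set"
  src :: "'a \<Rightarrow> 'a"
  rng :: "'a \<Rightarrow> 'a"
  cmp :: "'a \<Rightarrow> 'a \<Rightarrow> 'a"

definition category :: "'a cat \<Rightarrow> bool" where
  "category C \<longleftrightarrow>
    (\<forall>f\<in>Mor C. src C f \<in> Mor C \<and> rng C f \<in> Mor C \<and>
       src C (src C f) = src C f \<and> rng C (src C f) = src C f \<and>
       src C (rng C f) = rng C f \<and> rng C (rng C f) = rng C f \<and>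
       cmp C f (src C f) = f \<and> cmp C (rng C f) f = f) \<and>
    (\<forall>f\<in>Mor C. \<forall>g\<in>Mor C. src C f = rng C g \<longrightarrow>
       cmp C f g \<in> Mor C \<and> src C (cmp C f g) = src C g \<and> rng C (cmp C f g) = rng C f) \<and>
    (\<forall>f\<in>Mor C. \<forall>g\<in>Mor C. \<forall>h\<in>Mor C. src C f = rng C g \<and> src C g = rng C h \<longrightarrow>
       cmp C (cmp C f g) h = cmp C f (cmp C g h))"

definition Ob :: "'a cat \<Rightarrow> 'a set" where
  "Ob C = {X \<in> Mor C. src C X = X}"

definition mor_to :: "'a cat \<Rightarrow> 'a \<Rightarrow> 'a set" where
  "mor_to C X = {f \<in> Mor C. rng C f = X}"

definition is_functor :: "'a cat \<Rightarrow> 'b cat \<Rightarrow> ('a \<Rightarrow> 'b) \<Rightarrow> bool" where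
  "is_functor C D F \<longleftrightarrow> category C \<and> category D \<and>
    (\<forall>f\<in>Mor C. F f \<in> Mor D \<and> F (src C f) = src D (F f) \<and> F (rng C f) = rng D (F f)) \<and>
    (\<forall>f\<in>Mor C. \<forall>g\<in>Mor C. src C f = rng C g \<longrightarrow> F (cmp C f g) = cmp D (F f) (F g))"

text \<open>
  The object \<open>\<alpha>\<close> of the slice category \<open>C/X\<close> is represented by its identity morphism
  \<open>(\<alpha>, s(\<alpha>))\<close>.
\<close>

definition slice :: "'a cat \<Rightarrow> 'a \<Rightarrow> ('a \<times> 'a) cat" where
  "slice C X =
    \<lparr>Mor = {(\<alpha>, \<gamma>). \<alpha> \<in> mor_to C X \<and> \<gamma> \<in> Mor C \<and> rng C \<gamma> = src C \<alpha>},
     src = (\<lambda>(\<alpha>, \<gamma>). (cmp C \<alpha> \<gamma>, src C \<gamma>)),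
     rng = (\<lambda>(\<alpha>, \<gamma>). (\<alpha>, src C \<alpha>)),
     cmp = (\<lambda>(\<alpha>, \<gamma>) (\<beta>, \<delta>). (\<alpha>, cmp C \<gamma> \<delta>))\<rparr>"


section \<open>Kumjian-Pask fibrations\<close>

definition discrete_Conduche :: "'e cat \<Rightarrow> 'b cat \<Rightarrow> ('e \<Rightarrow> 'b) \<Rightarrow> bool" where
  "discrete_Conduche E B F \<longleftrightarrow> is_functor E B F \<and>
    (\<forall>\<phi>\<in>Mor E. \<forall>\<rho>\<in>Mor B. \<forall>\<sigma>\<in>Mor B. src B \<rho> = rng B \<sigma> \<and> F \<phi> = cmp B \<rho> \<sigma> \<longrightarrow>
      (\<exists>!p. fst p \<in> Mor E \<and> snd p \<in> Mor E \<and> src E (fst p) = rng E (snd p) \<and>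
            \<phi> = cmp E (fst p) (snd p) \<and> F (fst p) = \<rho> \<and> F (snd p) = \<sigma>))"

definition row_finite :: "'e cat \<Rightarrow> 'b cat \<Rightarrow> ('e \<Rightarrow> 'b) \<Rightarrow> bool" where
  "row_finite E B F \<longleftrightarrow>
    (\<forall>X\<in>Ob E. \<forall>b\<in>mor_to B (F X). finite {\<alpha> \<in> mor_to E X. F \<alpha> = b})"

definition right_Ore :: "'b cat \<Rightarrow> bool" where
  "right_Ore B \<longleftrightarrow>
    (\<forall>m\<in>Mor B. \<forall>n\<in>Mor B. rng B m = rng B n \<longrightarrow>
      (\<exists>p\<in>mor_to B (src B m). \<exists>q\<in>mor_to B (src B n). cmp B m p = cmp B n q))"

definition strongly_right_Ore :: "'b cat \<Rightarrow> bool" where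
  "strongly_right_Ore B \<longleftrightarrow> right_Ore B \<and>
    (\<forall>m\<in>Mor B. \<forall>n\<in>Mor B. rng B m = rng B n \<longrightarrow>
      (\<forall>p1\<in>mor_to B (src B m). \<forall>p2\<in>mor_to B (src B m).
       \<forall>q1\<in>mor_to B (src B n). \<forall>q2\<in>mor_to B (src B n).
        cmp B m p1 = cmp B n q1 \<and> cmp B m p2 = cmp B n q2 \<longrightarrow>
        (\<exists>a\<in>mor_to B (src B p1). \<exists>b\<in>mor_to B (src B p2).
           cmp B p1 a = cmp B p2 b \<and> cmp B q1 a = cmp B q2 b)))"

text \<open>
  The functor \<open>E/X \<rightarrow> B/F(X)\<close> induced by \<open>F\<close> is \<open>map_prod F F\<close>.  The values of a function
  outside the set of morphisms of its domain are irrelevant here.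
\<close>

definition is_section :: "'e cat \<Rightarrow> 'b cat \<Rightarrow> ('e \<Rightarrow> 'b) \<Rightarrow> 'e \<Rightarrow> ('b \<times> 'b \<Rightarrow> 'e \<times> 'e) \<Rightarrow> bool" where
  "is_section E B F X x \<longleftrightarrow> is_functor (slice B (F X)) (slice E X) x \<and>
    (\<forall>m\<in>Mor (slice B (F X)). map_prod F F (x m) = m)"

definition locally_split :: "'e cat \<Rightarrow> 'b cat \<Rightarrow> ('e \<Rightarrow> 'b) \<Rightarrow> bool" where
  "locally_split E B F \<longleftrightarrow> (\<forall>X\<in>Ob E. \<exists>x. is_section E B F X x)"

definition Kumjian_Pask_fibration :: "'e cat \<Rightarrow> 'b cat \<Rightarrow> ('e \<Rightarrow> 'b) \<Rightarrow> bool" where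
  "Kumjian_Pask_fibration E B F \<longleftrightarrow>
    discrete_Conduche E B F \<and> locally_split E B F \<and> strongly_right_Ore B"


section \<open>Infinite paths\<close>

text \<open>
  An infinite path is a pair \<open>(X, x)\<close>, so that it remembers its object \<open>X\<close>.  The function \<open>x\<close>
  is required to be \<^const>\<open>undefined\<close> outside the morphisms of \<open>B/F(X)\<close>, so that equality of
  paths is equality of functors.
\<close>

type_synonym ('e, 'b) path = "'e \<times> ('b \<times> 'b \<Rightarrow> 'e \<times> 'e)"

definition paths_to :: "'e cat \<Rightarrow> 'b cat \<Rightarrow> ('e \<Rightarrow> 'b) \<Rightarrow> 'e \<Rightarrow> ('e, 'b) path set" where
  "paths_to E B F X =
    {X} \<times> {x. is_section E B F X x \<and> x \<in> extensional (Mor (slice B (F X)))}"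

definition inf_paths :: "'e cat \<Rightarrow> 'b cat \<Rightarrow> ('e \<Rightarrow> 'b) \<Rightarrow> ('e, 'b) path set" where
  "inf_paths E B F = (\<Union>X\<in>Ob E. paths_to E B F X)"

definition path_at :: "'b cat \<Rightarrow> ('e, 'b) path \<Rightarrow> 'b \<Rightarrow> 'e" where
  "path_at B x a = fst (snd x (a, src B a))"

definition path_step :: "('e, 'b) path \<Rightarrow> 'b \<Rightarrow> 'b \<Rightarrow> 'e" where
  "path_step x a b = snd (snd x (a, b))"

definition cyl :: "'e cat \<Rightarrow> 'b cat \<Rightarrow> ('e \<Rightarrow> 'b) \<Rightarrow> 'e \<Rightarrow> ('e, 'b) path set" where
  "cyl E B F \<mu> = {x \<in> paths_to E B F (rng E \<mu>). path_at B x (F \<mu>) = \<mu>}"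

definition res :: "'e cat \<Rightarrow> 'b cat \<Rightarrow> ('e \<Rightarrow> 'b) \<Rightarrow> 'e \<Rightarrow> ('e, 'b) path \<Rightarrow> ('e, 'b) path" where
  "res E B F \<mu> x =
    (src E \<mu>,
     \<lambda>(a, b)\<in>Mor (slice B (F (src E \<mu>))).
        (path_step x (F \<mu>) a, path_step x (cmp B (F \<mu>) a) b))"

text \<open>\<open>res \<mu>\<close> is a bijection \<open>Z(\<mu>) \<rightarrow> Z(s(\<mu>))\<close>, and \<open>ind \<mu>\<close> is its inverse.\<close>

definition ind :: "'e cat \<Rightarrow> 'b cat \<Rightarrow> ('e \<Rightarrow> 'b) \<Rightarrow> 'e \<Rightarrow> ('e, 'b) path \<Rightarrow> ('e, 'b) path" where
  "ind E B F \<mu> = inv_into (cyl E B F \<mu>) (res E B F \<mu>)"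


section \<open>The groupoid of germs as a topological space\<close>

type_synonym ('e, 'b) triple = "'e \<times> 'e \<times> ('e, 'b) path"

definition is_span :: "'e cat \<Rightarrow> 'e \<Rightarrow> 'e \<Rightarrow> bool" where
  "is_span E \<mu> \<nu> \<longleftrightarrow> \<mu> \<in> Mor E \<and> \<nu> \<in> Mor E \<and> src E \<mu> = src E \<nu>"

definition triples :: "'e cat \<Rightarrow> 'b cat \<Rightarrow> ('e \<Rightarrow> 'b) \<Rightarrow> ('e, 'b) triple set" where
  "triples E B F =
    {(\<mu>, \<nu>, x). is_span E \<mu> \<nu> \<and> x \<in> inf_paths E B F \<and> x \<in> cyl E B F \<nu>}"

definition germ_rel ::
    "'e cat \<Rightarrow> 'b cat \<Rightarrow> ('e \<Rightarrow> 'b) \<Rightarrow> (('e, 'b) triple \<times> ('e, 'b) triple) set" where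
  "germ_rel E B F =
    {((\<mu>, \<nu>, x), (\<mu>', \<nu>', x')).
       (\<mu>, \<nu>, x) \<in> triples E B F \<and> (\<mu>', \<nu>', x') \<in> triples E B F \<and>
       x = x' \<and>
       (\<exists>\<kappa>\<in>Mor E. x \<in> cyl E B F \<kappa> \<and> cyl E B F \<kappa> \<subseteq> cyl E B F \<nu> \<inter> cyl E B F \<nu>' \<and>
          (\<forall>y\<in>cyl E B F \<kappa>.
             ind E B F \<mu> (res E B F \<nu> y) = ind E B F \<mu>' (res E B F \<nu>' y))) \<and>
       (\<exists>a\<in>mor_to B (src B (F \<mu>)). \<exists>b\<in>mor_to B (src B (F \<mu>')).
          cmp B (F \<mu>) a = cmp B (F \<mu>') b \<and> cmp B (F \<nu>) a = cmp B (F \<nu>') b)}"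

definition germs :: "'e cat \<Rightarrow> 'b cat \<Rightarrow> ('e \<Rightarrow> 'b) \<Rightarrow> ('e, 'b) triple set set" where
  "germs E B F = triples E B F // germ_rel E B F"

definition germ ::
    "'e cat \<Rightarrow> 'b cat \<Rightarrow> ('e \<Rightarrow> 'b) \<Rightarrow> 'e \<Rightarrow> 'e \<Rightarrow> ('e, 'b) path \<Rightarrow> ('e, 'b) triple set" where
  "germ E B F \<mu> \<nu> x = germ_rel E B F `` {(\<mu>, \<nu>, x)}"

definition germ_cyl ::
    "'e cat \<Rightarrow> 'b cat \<Rightarrow> ('e \<Rightarrow> 'b) \<Rightarrow> 'e \<Rightarrow> 'e \<Rightarrow> ('e, 'b) triple set set" where
  "germ_cyl E B F \<mu> \<nu> = germ E B F \<mu> \<nu> ` cyl E B F \<nu>"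

lemma cyl_subset_inf_paths:
  assumes "category E" "\<nu> \<in> Mor E"
  shows "cyl E B F \<nu> \<subseteq> inf_paths E B F"
proof -
  have "rng E \<nu> \<in> Ob E"
    using assms unfolding category_def Ob_def by blast
  then show ?thesis
    unfolding cyl_def inf_paths_def by blast
qed

lemma Union_germ_cyl:
  assumes "category E"
  shows "\<Union> {germ_cyl E B F \<mu> \<nu> |\<mu> \<nu>. is_span E \<mu> \<nu>} = germs E B F"
proof (intro set_eqI iffI)
  fix g assume "g \<in> \<Union> {germ_cyl E B F \<mu> \<nu> |\<mu> \<nu>. is_span E \<mu> \<nu>}"
  then obtain \<mu> \<nu> x where g: "is_span E \<mu> \<nu>" "x \<in> cyl E B F \<nu>" "g = germ E B F \<mu> \<nu> x"
    unfolding germ_cyl_def by blast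
  have "x \<in> inf_paths E B F"
    using cyl_subset_inf_paths[OF assms] g(1,2) unfolding is_span_def by blast
  then have "(\<mu>, \<nu>, x) \<in> triples E B F"
    using g(1,2) unfolding triples_def by simp
  then show "g \<in> germs E B F"
    unfolding germs_def g(3) germ_def by (rule quotientI)
next
  fix g assume "g \<in> germs E B F"
  then obtain t where t: "t \<in> triples E B F" "g = germ_rel E B F `` {t}"
    unfolding germs_def by (rule quotientE)
  obtain \<mu> \<nu> x where x: "t = (\<mu>, \<nu>, x)"
    by (rule prod_cases3)
  have "is_span E \<mu> \<nu>" "x \<in> cyl E B F \<nu>"
    using t(1) unfolding x triples_def by simp_all
  moreover from this(2) have "g \<in> germ_cyl E B F \<mu> \<nu>"
    unfolding germ_cyl_def germ_def t(2) x by (rule imageI)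
  ultimately show "g \<in> \<Union> {germ_cyl E B F \<mu> \<nu> |\<mu> \<nu>. is_span E \<mu> \<nu>}"
    by blast
qed

text \<open>
  The open sets are the unions of sets \<open>Z(\<mu>, \<nu>)\<close>.  By the preceding lemma these cover
  \<open>germs E B F\<close>, which is therefore the underlying set of the space.
\<close>

definition germ_topology ::
    "'e cat \<Rightarrow> 'b cat \<Rightarrow> ('e \<Rightarrow> 'b) \<Rightarrow> ('e, 'b) triple set topology" where
  "germ_topology E B F =
    topology (arbitrary union_of (\<lambda>U. \<exists>\<mu> \<nu>. is_span E \<mu> \<nu> \<and> U = germ_cyl E B F \<mu> \<nu>))"

definition totally_disconnected_space :: "'a topology \<Rightarrow> bool" where
  "totally_disconnected_space T \<longleftrightarrow> (\<forall>S. connectedin T S \<longrightarrow> (\<exists>a. S \<subseteq> {a}))"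

end

theory Submission
  imports Defs
begin

text \<open>
  The argument compares the germ space with the space of infinite paths.  On a basic open set
  \<open>Z(\<mu>, \<nu>)\<close> the germ \<open>[\<mu>, \<nu>, x]\<close> is determined by \<open>x \<in> Z(\<nu>)\<close>, and shrinking the path
  cylinder to \<open>Z(\<nu>\<eta>)\<close> does not change the germ: \<open>[\<mu>\<eta>, \<nu>\<eta>, x] = [\<mu>, \<nu>, x]\<close> (\<open>germ_extend\<close>).
  So the images of the cylinders \<open>Z(\<nu>\<eta>)\<close> are again basic open, and if a germ \<open>[\<mu>, \<nu>, x]\<close> lies in
  \<open>Z(\<mu>', \<nu>')\<close>, then so do all \<open>[\<mu>, \<nu>, y]\<close> with \<open>y\<close> in a small enough such cylinder
  (\<open>germ_neighbourhood\<close>).  This makes the sets \<open>Z(\<mu>, \<nu>)\<close> a basis and makes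
  \<open>x \<mapsto> [\<mu>, \<nu>, x]\<close> continuous on \<open>Z(\<nu>)\<close>.

  Compactness.  By unique factorization an infinite path to \<open>X\<close> is the same thing as a choice of
  lifts \<open>x(a) \<in> X E\<close> of all \<open>a \<in> F(X) B\<close> such that \<open>x(ab) = x(a)\<gamma>\<close> with
  \<open>\<gamma>\<close> a lift of \<open>b\<close>.  Row-finiteness says that each \<open>a\<close> has finitely many lifts, so by Tychonoff's theorem all choices of lifts form a
  compact space, in which coherence is a closed condition because each instance involves two
  coordinates.  Hence \<open>Z(\<mu>, \<nu>)\<close>, as a continuous image, is compact (\<open>compactin_germ_cyl\<close>).

  Separation.  Let \<open>[\<mu>, \<nu>, x]\<close> and \<open>[\<mu>', \<nu>', x']\<close> be distinct.  If \<open>x \<noteq> x'\<close>, disjoint cylinders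
  around \<open>x\<close> and \<open>x'\<close> separate them.  If \<open>x = x'\<close> and no \<open>a, b\<close> satisfy \<open>F(\<mu>)a = F(\<mu>')b\<close> and
  \<open>F(\<nu>)a = F(\<nu>')b\<close>, then \<open>Z(\<mu>, \<nu>)\<close> and \<open>Z(\<mu>', \<nu>')\<close> are disjoint, since this condition does not
  involve the path.  If such \<open>a, b\<close> exist, extending both germs along \<open>x\<close> reduces to the case
  \<open>\<nu> = \<nu>'\<close>, \<open>F(\<mu>) = F(\<mu>')\<close>, \<open>\<mu> \<noteq> \<mu>'\<close>; then \<open>ind \<mu>\<close> and \<open>ind \<mu>'\<close> take values in the disjoint
  sets \<open>Z(\<mu>)\<close> and \<open>Z(\<mu>')\<close>, so again \<open>Z(\<mu>, \<nu>)\<close> and \<open>Z(\<mu>', \<nu>')\<close> are disjoint (\<open>separate_germs\<close>).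

  Compact open sets in a Hausdorff space are clopen, so the same separation also gives total
  disconnectedness.

  The strong right Ore condition enters where paths are concatenated: the formula
  \<open>y(F(\<mu>)a) = \<mu> x(a)\<close> for \<open>y = ind \<mu>(x)\<close> has to be shown unambiguous (\<open>initial_unique\<close>) although
  \<open>F(\<mu>)a = F(\<mu>)a'\<close> need not imply \<open>a = a'\<close>.
\<close>

section \<open>Categories and unique factorization\<close>

lemma mor_toD [dest]:
  assumes "f \<in> mor_to C X"
  shows "f \<in> Mor C" "rng C f = X"
  using assms unfolding mor_to_def by auto

locale small_category =
  fixes C :: "'a cat"
  assumes category: "category C"
begin

lemma src_rng_mor [simp]:
  assumes "f \<in> Mor C"
  shows "src C f \<in> Mor C" "rng C f \<in> Mor C" "src C (src C f) = src C f" "rng C (src C f) = src C f"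
    "src C (rng C f) = rng C f" "rng C (rng C f) = rng C f"
    "cmp C f (src C f) = f" "cmp C (rng C f) f = f"
  using category assms unfolding category_def by blast+

lemma src_in_mor_to [simp]: "f \<in> Mor C \<Longrightarrow> src C f \<in> mor_to C (src C f)"
  unfolding mor_to_def by simp

lemma mor_to_rng [simp]: "f \<in> Mor C \<Longrightarrow> f \<in> mor_to C (rng C f)"
  unfolding mor_to_def by simp

lemma rng_Ob [simp]: "f \<in> Mor C \<Longrightarrow> rng C f \<in> Ob C"
  unfolding Ob_def by simp

lemma src_Ob [simp]: "f \<in> Mor C \<Longrightarrow> src C f \<in> Ob C"
  unfolding Ob_def by simp

lemma comp_mor [simp]:
  assumes "f \<in> Mor C" "g \<in> mor_to C (src C f)"
  shows "cmp C f g \<in> Mor C" "src C (cmp C f g) = src C g" "rng C (cmp C f g) = rng C f"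
proof -
  have "g \<in> Mor C" "src C f = rng C g" using assms(2) by auto
  then have "cmp C f g \<in> Mor C \<and> src C (cmp C f g) = src C g \<and> rng C (cmp C f g) = rng C f"
    using category assms(1) unfolding category_def by blast
  then show "cmp C f g \<in> Mor C" "src C (cmp C f g) = src C g" "rng C (cmp C f g) = rng C f"
    by simp_all
qed

lemma comp_mor_to [simp]:
  assumes "f \<in> mor_to C X" "g \<in> mor_to C (src C f)"
  shows "cmp C f g \<in> mor_to C X"
  using assms comp_mor[of f g] unfolding mor_to_def by auto

lemma comp_id_left [simp]: "f \<in> mor_to C X \<Longrightarrow> cmp C X f = f"
  unfolding mor_to_def by auto

lemma comp_id_right [simp]: "f \<in> Mor C \<Longrightarrow> src C f = X \<Longrightarrow> cmp C f X = f"
  by auto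

lemma comp_assoc:
  assumes "f \<in> Mor C" "g \<in> mor_to C (src C f)" "h \<in> mor_to C (src C g)"
  shows "cmp C (cmp C f g) h = cmp C f (cmp C g h)"
proof -
  have "g \<in> Mor C" "src C f = rng C g" "h \<in> Mor C" "src C g = rng C h" using assms by auto
  then show ?thesis
    using category assms(1) unfolding category_def by blast
qed

lemma mem_slice [simp]:
  "(\<alpha>, \<gamma>) \<in> Mor (slice C X) \<longleftrightarrow> \<alpha> \<in> mor_to C X \<and> \<gamma> \<in> mor_to C (src C \<alpha>)"
  unfolding slice_def mor_to_def by auto

lemma slice_ops [simp]:
  "src (slice C X) (\<alpha>, \<gamma>) = (cmp C \<alpha> \<gamma>, src C \<gamma>)"
  "rng (slice C X) (\<alpha>, \<gamma>) = (\<alpha>, src C \<alpha>)"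
  "cmp (slice C X) (\<alpha>, \<gamma>) (\<beta>, \<delta>) = (\<alpha>, cmp C \<gamma> \<delta>)"
  unfolding slice_def by auto

lemma category_slice: "category (slice C X)"
proof -
  have "src (slice C X) f \<in> Mor (slice C X) \<and> rng (slice C X) f \<in> Mor (slice C X) \<and>
       src (slice C X) (src (slice C X) f) = src (slice C X) f \<and>
       rng (slice C X) (src (slice C X) f) = src (slice C X) f \<and>
       src (slice C X) (rng (slice C X) f) = rng (slice C X) f \<and>
       rng (slice C X) (rng (slice C X) f) = rng (slice C X) f \<and>
       cmp (slice C X) f (src (slice C X) f) = f \<and> cmp (slice C X) (rng (slice C X) f) f = f"
    if f: "f \<in> Mor (slice C X)" for f
  proof -
    obtain a b where ab: "f = (a, b)" "a \<in> mor_to C X" "b \<in> mor_to C (src C a)"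
      using f by (cases f) auto
    then have "a \<in> Mor C" "b \<in> Mor C" by auto
    then show ?thesis using ab by simp
  qed
  moreover have "cmp (slice C X) f g \<in> Mor (slice C X) \<and>
       src (slice C X) (cmp (slice C X) f g) = src (slice C X) g \<and>
       rng (slice C X) (cmp (slice C X) f g) = rng (slice C X) f"
    if "f \<in> Mor (slice C X)" "g \<in> Mor (slice C X)" "src (slice C X) f = rng (slice C X) g" for f g
  proof -
    obtain a b a' c where fg: "f = (a, b)" "g = (a', c)" by (cases f, cases g)
    then have abc: "f = (a, b)" "g = (cmp C a b, c)" "a \<in> mor_to C X"
      "b \<in> mor_to C (src C a)" "c \<in> mor_to C (src C b)"
      using that by auto
    then have "a \<in> Mor C" "b \<in> Mor C" by auto
    then show ?thesis using abc comp_assoc by simp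
  qed
  moreover have "cmp (slice C X) (cmp (slice C X) f g) h = cmp (slice C X) f (cmp (slice C X) g h)"
    if "f \<in> Mor (slice C X)" "g \<in> Mor (slice C X)" "h \<in> Mor (slice C X)"
      "src (slice C X) f = rng (slice C X) g" "src (slice C X) g = rng (slice C X) h" for f g h
  proof -
    obtain a b a' c a'' d where fgh: "f = (a, b)" "g = (a', c)" "h = (a'', d)"
      by (cases f, cases g, cases h)
    then have abcd: "f = (a, b)" "g = (cmp C a b, c)" "h = (a'', d)"
      "b \<in> mor_to C (src C a)" "c \<in> mor_to C (src C b)" "d \<in> mor_to C (src C c)"
      using that by auto
    then have "b \<in> Mor C" by auto
    then show ?thesis using abcd comp_assoc by simp
  qed
  ultimately show ?thesis
    unfolding category_def by (intro conjI ballI impI) auto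
qed

end

locale conduche_ore =
  fixes E :: "'e cat" and B :: "'b cat" and F :: "'e \<Rightarrow> 'b"
  assumes conduche: "discrete_Conduche E B F"
    and strong_ore: "strongly_right_Ore B"
begin

lemma functor_F: "is_functor E B F"
  using conduche unfolding discrete_Conduche_def by simp

sublocale E: small_category E
  using functor_F unfolding is_functor_def by unfold_locales simp

sublocale B: small_category B
  using functor_F unfolding is_functor_def by unfold_locales simp

text \<open>
  Below, \<open>val x a\<close> is the morphism \<open>x(a)\<close> and \<open>step x a b\<close> is \<open>x\<^sub>2(a, b)\<close>, so that
  \<open>x(ab) = x(a) x\<^sub>2(a, b)\<close>.
\<close>

abbreviation comp_E (infixl "\<cdot>" 70) where "f \<cdot> g \<equiv> cmp E f g"
abbreviation comp_B (infixl "\<odot>" 70) where "a \<odot> b \<equiv> cmp B a b"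
abbreviation Z where "Z \<equiv> cyl E B F"
abbreviation paths where "paths \<equiv> paths_to E B F"
abbreviation val where "val \<equiv> path_at B"
abbreviation step where "step \<equiv> path_step"

lemma F_simps [simp]:
  assumes "f \<in> Mor E"
  shows "F f \<in> Mor B" "F (src E f) = src B (F f)" "F (rng E f) = rng B (F f)"
  using functor_F assms unfolding is_functor_def by auto

lemma F_mor_to [simp]: "f \<in> mor_to E X \<Longrightarrow> F f \<in> mor_to B (F X)"
  unfolding mor_to_def by auto

lemma F_mor_to_src: "f \<in> Mor E \<Longrightarrow> g \<in> mor_to E (src E f) \<Longrightarrow> F g \<in> mor_to B (src B (F f))"
  using F_mor_to by fastforce

lemma F_comp [simp]: "f \<in> Mor E \<Longrightarrow> g \<in> mor_to E (src E f) \<Longrightarrow> F (f \<cdot> g) = F f \<odot> F g"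
  using functor_F unfolding is_functor_def mor_to_def by auto

lemma factorization:
  assumes "\<phi> \<in> Mor E" "a \<in> Mor B" "b \<in> mor_to B (src B a)" "F \<phi> = a \<odot> b"
  obtains \<alpha> \<gamma> where "\<alpha> \<in> mor_to E (rng E \<phi>)" "\<gamma> \<in> mor_to E (src E \<alpha>)" "\<phi> = \<alpha> \<cdot> \<gamma>" "F \<alpha> = a" "F \<gamma> = b"
proof -
  have "src B a = rng B b" "b \<in> Mor B" using assms by auto
  then have "\<exists>p. fst p \<in> Mor E \<and> snd p \<in> Mor E \<and> src E (fst p) = rng E (snd p) \<and>
            \<phi> = fst p \<cdot> snd p \<and> F (fst p) = a \<and> F (snd p) = b"
    using conduche assms unfolding discrete_Conduche_def by blast
  then obtain p where p: "fst p \<in> Mor E" "snd p \<in> mor_to E (src E (fst p))"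
    "\<phi> = fst p \<cdot> snd p" "F (fst p) = a" "F (snd p) = b"
    by (metis E.mor_to_rng)
  then have "fst p \<in> mor_to E (rng E \<phi>)" by simp
  then show thesis using that p by blast
qed

lemma factorization_unique:
  assumes "\<alpha> \<in> Mor E" "\<gamma> \<in> mor_to E (src E \<alpha>)" "\<alpha>' \<in> Mor E" "\<gamma>' \<in> mor_to E (src E \<alpha>')"
    and eq: "\<alpha> \<cdot> \<gamma> = \<alpha>' \<cdot> \<gamma>'" "F \<alpha> = F \<alpha>'" "F \<gamma> = F \<gamma>'"
  shows "\<alpha> = \<alpha>'" "\<gamma> = \<gamma>'"
proof -
  have "\<alpha> \<cdot> \<gamma> \<in> Mor E" "F \<alpha> \<in> Mor B" "F \<gamma> \<in> Mor B" "src B (F \<alpha>) = rng B (F \<gamma>)"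
    "F (\<alpha> \<cdot> \<gamma>) = F \<alpha> \<odot> F \<gamma>"
    using assms(1,2) F_mor_to_src[of \<alpha> \<gamma>] by auto
  then have "\<exists>!p. fst p \<in> Mor E \<and> snd p \<in> Mor E \<and> src E (fst p) = rng E (snd p) \<and>
            \<alpha> \<cdot> \<gamma> = fst p \<cdot> snd p \<and> F (fst p) = F \<alpha> \<and> F (snd p) = F \<gamma>"
    using conduche unfolding discrete_Conduche_def by blast
  then have "(\<alpha>, \<gamma>) = (\<alpha>', \<gamma>')"
    by (rule ex1E) (metis assms mor_toD fst_conv snd_conv)
  then show "\<alpha> = \<alpha>'" "\<gamma> = \<gamma>'" by simp_all
qed

lemma ore:
  assumes "m \<in> mor_to B Y" "n \<in> mor_to B Y"
  obtains p q where "p \<in> mor_to B (src B m)" "q \<in> mor_to B (src B n)" "m \<odot> p = n \<odot> q"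
proof -
  have "m \<in> Mor B" "n \<in> Mor B" "rng B m = rng B n" using assms by auto
  then have "\<exists>p\<in>mor_to B (src B m). \<exists>q\<in>mor_to B (src B n). m \<odot> p = n \<odot> q"
    using strong_ore unfolding strongly_right_Ore_def right_Ore_def by blast
  then show thesis using that by blast
qed

lemma ore_strong:
  assumes "m \<in> mor_to B Y" "n \<in> mor_to B Y"
    and "p\<^sub>1 \<in> mor_to B (src B m)" "p\<^sub>2 \<in> mor_to B (src B m)"
    and "q\<^sub>1 \<in> mor_to B (src B n)" "q\<^sub>2 \<in> mor_to B (src B n)"
    and "m \<odot> p\<^sub>1 = n \<odot> q\<^sub>1" "m \<odot> p\<^sub>2 = n \<odot> q\<^sub>2"
  obtains a b where "a \<in> mor_to B (src B p\<^sub>1)" "b \<in> mor_to B (src B p\<^sub>2)"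
    "p\<^sub>1 \<odot> a = p\<^sub>2 \<odot> b" "q\<^sub>1 \<odot> a = q\<^sub>2 \<odot> b"
proof -
  have mn: "m \<in> Mor B" "n \<in> Mor B" "rng B m = rng B n" using assms by auto
  have "\<exists>a\<in>mor_to B (src B p\<^sub>1). \<exists>b\<in>mor_to B (src B p\<^sub>2).
           p\<^sub>1 \<odot> a = p\<^sub>2 \<odot> b \<and> q\<^sub>1 \<odot> a = q\<^sub>2 \<odot> b"
    using strong_ore[unfolded strongly_right_Ore_def, THEN conjunct2, rule_format,
        OF mn assms(3-6)] assms(7,8) by simp
  then show thesis using that by blast
qed

section \<open>Infinite paths as coherent choices of lifts\<close>

text \<open>
  The value of a path on objects determines the path: \<open>x\<^sub>2(a, b)\<close> is the unique lift of \<open>b\<close> that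
  completes \<open>x(a)\<close> to \<open>x(ab)\<close>, and functoriality follows from that uniqueness.  A thread is the
  data that remains, and it is far easier to construct and to topologize than a functor between
  slice categories.
\<close>

definition thread :: "'e \<Rightarrow> ('b \<Rightarrow> 'e) \<Rightarrow> bool" where
  "thread X f \<longleftrightarrow>
    (\<forall>a\<in>mor_to B (F X). f a \<in> mor_to E X \<and> F (f a) = a \<and>
      (\<forall>b\<in>mor_to B (src B a). \<exists>\<gamma>\<in>mor_to E (src E (f a)). F \<gamma> = b \<and> f (a \<odot> b) = f a \<cdot> \<gamma>))"

definition next_step :: "('b \<Rightarrow> 'e) \<Rightarrow> 'b \<Rightarrow> 'b \<Rightarrow> 'e" where
  "next_step f a b = (THE \<gamma>. \<gamma> \<in> mor_to E (src E (f a)) \<and> F \<gamma> = b \<and> f (a \<odot> b) = f a \<cdot> \<gamma>)"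

definition path_of :: "'e \<Rightarrow> ('b \<Rightarrow> 'e) \<Rightarrow> ('e, 'b) path" where
  "path_of X f = (X, \<lambda>(a, b)\<in>Mor (slice B (F X)). (f a, next_step f a b))"

lemma threadD:
  assumes "thread X f" "a \<in> mor_to B (F X)"
  shows "f a \<in> mor_to E X" "F (f a) = a" "src B a = F (src E (f a))"
proof -
  show fa: "f a \<in> mor_to E X" "F (f a) = a"
    using assms unfolding thread_def by blast+
  have "f a \<in> Mor E" using fa by blast
  then show "src B a = F (src E (f a))" using fa(2) by simp
qed

lemma next_step_unique:
  assumes "f a \<in> Mor E" "\<gamma> \<in> mor_to E (src E (f a))" "F \<gamma> = b" "f (a \<odot> b) = f a \<cdot> \<gamma>"
  shows "next_step f a b = \<gamma>"
  unfolding next_step_def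
proof (rule the_equality)
  show "\<gamma> \<in> mor_to E (src E (f a)) \<and> F \<gamma> = b \<and> f (a \<odot> b) = f a \<cdot> \<gamma>" using assms by simp
  show "\<delta> = \<gamma>" if "\<delta> \<in> mor_to E (src E (f a)) \<and> F \<delta> = b \<and> f (a \<odot> b) = f a \<cdot> \<delta>" for \<delta>
    using factorization_unique(2)[of "f a" \<delta> "f a" \<gamma>] assms that by simp
qed

lemma next_step:
  assumes "thread X f" "a \<in> mor_to B (F X)" "b \<in> mor_to B (src B a)"
  shows "next_step f a b \<in> mor_to E (src E (f a))" "F (next_step f a b) = b"
    "f (a \<odot> b) = f a \<cdot> next_step f a b"
proof -
  obtain \<gamma> where \<gamma>: "\<gamma> \<in> mor_to E (src E (f a))" "F \<gamma> = b" "f (a \<odot> b) = f a \<cdot> \<gamma>"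
    using assms unfolding thread_def by blast
  have "next_step f a b = \<gamma>"
    using next_step_unique[of f a \<gamma> b] \<gamma> threadD(1)[OF assms(1,2)] by auto
  then show "next_step f a b \<in> mor_to E (src E (f a))" "F (next_step f a b) = b"
    "f (a \<odot> b) = f a \<cdot> next_step f a b" using \<gamma> by auto
qed

lemma next_step_src:
  assumes "thread X f" "a \<in> mor_to B (F X)"
  shows "next_step f a (src B a) = src E (f a)"
proof -
  have "f a \<in> Mor E" "a \<in> Mor B" "F (f a) = a" using threadD[OF assms] assms by auto
  then show ?thesis
    by (intro next_step_unique) auto
qed

text \<open>
  This is the multiplicativity that makes a thread a functor on the slice category: both sides
  complete \<open>f(a)\<close> to \<open>f(abc)\<close> and lie over \<open>bc\<close>.
\<close>

lemma next_step_comp: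
  assumes f: "thread X f" and a: "a \<in> mor_to B (F X)" and b: "b \<in> mor_to B (src B a)"
    and c: "c \<in> mor_to B (src B b)"
  shows "next_step f a (b \<odot> c) = next_step f a b \<cdot> next_step f (a \<odot> b) c"
proof -
  have ab: "a \<odot> b \<in> mor_to B (F X)" using a b by simp
  have m: "a \<in> Mor B" "b \<in> Mor B" "f a \<in> Mor E" "src B (a \<odot> b) = src B b"
    using a b threadD[OF f a] by auto
  note s = next_step[OF f a b] next_step[OF f ab, unfolded m(4), OF c]
  have "next_step f a b \<in> Mor E" using s by blast
  moreover have "src E (f (a \<odot> b)) = src E (next_step f a b)" using s m by simp
  moreover have "f (a \<odot> (b \<odot> c)) = f a \<cdot> (next_step f a b \<cdot> next_step f (a \<odot> b) c)"
    using s m calculation B.comp_assoc[OF m(1) b c]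
      E.comp_assoc[of "f a" "next_step f a b" "next_step f (a \<odot> b) c"] by simp
  ultimately show ?thesis
    using s m by (intro next_step_unique) auto
qed

lemma path_of_in_paths:
  assumes X: "X \<in> Ob E" and f: "thread X f"
  shows "path_of X f \<in> paths X"
proof -
  define x where "x = snd (path_of X f)"
  have x: "x (a, b) = (f a, next_step f a b)"
    if "a \<in> mor_to B (F X)" "b \<in> mor_to B (src B a)" for a b
    using that unfolding x_def path_of_def by simp
  have "is_functor (slice B (F X)) (slice E X) x"
    unfolding is_functor_def
  proof (intro conjI ballI impI B.category_slice E.category_slice)
    fix m assume m: "m \<in> Mor (slice B (F X))"
    then obtain a b where ab: "m = (a, b)" "a \<in> mor_to B (F X)" "b \<in> mor_to B (src B a)"
      by (cases m) auto
    note fa = threadD[OF f ab(2)] and s = next_step[OF f ab(2,3)]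
    have M: "a \<in> Mor B" "b \<in> Mor B" "f a \<in> Mor E" "next_step f a b \<in> Mor E"
      using ab fa s by auto
    show "x m \<in> Mor (slice E X)" using ab fa s x by simp
    have "next_step f (a \<odot> b) (src B b) = src E (next_step f a b)"
      using next_step_src[OF f, of "a \<odot> b"] ab s M by simp
    then show "x (src (slice B (F X)) m) = src (slice E X) (x m)"
      using ab s M x by simp
    show "x (rng (slice B (F X)) m) = rng (slice E X) (x m)"
      using ab s M x next_step_src[OF f] by simp
  next
    fix m n assume "m \<in> Mor (slice B (F X))" "n \<in> Mor (slice B (F X))"
      "src (slice B (F X)) m = rng (slice B (F X)) n"
    moreover obtain a b a' c where "m = (a, b)" "n = (a', c)" by (cases m, cases n)
    ultimately have abc: "m = (a, b)" "n = (a \<odot> b, c)" "a \<in> mor_to B (F X)"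
      "b \<in> mor_to B (src B a)" "c \<in> mor_to B (src B b)"
      by auto
    moreover have "a \<in> Mor B" "b \<in> Mor B" using abc by auto
    ultimately show "x (cmp (slice B (F X)) m n) = cmp (slice E X) (x m) (x n)"
      using next_step_comp[OF f abc(3-5)] x by simp
  qed
  moreover have "map_prod F F (x m) = m" if "m \<in> Mor (slice B (F X))" for m
    using that x threadD(2)[OF f] next_step(2)[OF f] by (cases m) auto
  moreover have "x \<in> extensional (Mor (slice B (F X)))"
    unfolding x_def path_of_def by simp
  ultimately show ?thesis
    unfolding paths_to_def is_section_def x_def by (simp add: path_of_def)
qed

lemma at_path_of:
  assumes "a \<in> mor_to B (F X)"
  shows "val (path_of X f) a = f a"
proof -
  have "a \<in> Mor B" using assms by blast
  then show ?thesis
    using assms unfolding path_at_def path_of_def by simp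
qed

lemma path_steps:
  assumes x: "x \<in> paths X" and a: "a \<in> mor_to B (F X)" and b: "b \<in> mor_to B (src B a)"
  shows "val x a \<in> mor_to E X" "F (val x a) = a" "step x a b \<in> mor_to E (src E (val x a))"
    "F (step x a b) = b" "val x (a \<odot> b) = val x a \<cdot> step x a b" "snd x (a, b) = (val x a, step x a b)"
proof -
  obtain g where xg: "x = (X, g)" and g: "is_section E B F X g"
    using x unfolding paths_to_def by auto
  have ab: "a \<in> Mor B" "b \<in> Mor B" "rng B b = src B a" using a b by auto
  have fn: "is_functor (slice B (F X)) (slice E X) g" using g unfolding is_section_def by simp
  obtain \<alpha> \<gamma> where \<alpha>: "g (a, b) = (\<alpha>, \<gamma>)" by fastforce
  have m: "(a, b) \<in> Mor (slice B (F X))" using a b by simp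
  have "(\<alpha>, \<gamma>) \<in> Mor (slice E X)" "g (a \<odot> b, src B b) = (\<alpha> \<cdot> \<gamma>, src E \<gamma>)"
    "g (a, src B a) = (\<alpha>, src E \<alpha>)"
    using fn m \<alpha> unfolding is_functor_def by (metis B.slice_ops E.slice_ops)+
  moreover have "F \<alpha> = a" "F \<gamma> = b"
    using g m \<alpha> unfolding is_section_def by (metis map_prod_simp prod.inject)+
  ultimately show "val x a \<in> mor_to E X" "F (val x a) = a" "step x a b \<in> mor_to E (src E (val x a))"
    "F (step x a b) = b" "val x (a \<odot> b) = val x a \<cdot> step x a b" "snd x (a, b) = (val x a, step x a b)"
    using \<alpha> ab b unfolding path_at_def path_step_def xg by auto
qed

lemma path_at:
  assumes "x \<in> paths X" "a \<in> mor_to B (F X)"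
  shows "val x a \<in> mor_to E X" "val x a \<in> Mor E" "F (val x a) = a"
  using path_steps(1,2)[OF assms B.src_in_mor_to] assms(2) by auto

lemma thread_at:
  assumes "x \<in> paths X"
  shows "thread X (val x)"
proof -
  have "\<exists>\<gamma>\<in>mor_to E (src E (val x a)). F \<gamma> = b \<and> val x (a \<odot> b) = val x a \<cdot> \<gamma>"
    if "a \<in> mor_to B (F X)" "b \<in> mor_to B (src B a)" for a b
    using path_steps(3-5)[OF assms that] by (intro bexI[of _ "step x a b"]) auto
  then show ?thesis
    unfolding thread_def using path_at[OF assms] by simp
qed

lemma step_eq_next_step:
  assumes "x \<in> paths X" "a \<in> mor_to B (F X)" "b \<in> mor_to B (src B a)"
  shows "step x a b = next_step (val x) a b"
  using next_step_unique[of "val x" a "step x a b" b] path_steps[OF assms] path_at[OF assms(1,2)]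
  by auto

lemma fst_path [simp]: "x \<in> paths X \<Longrightarrow> fst x = X"
  unfolding paths_to_def by auto

lemma path_eqI:
  assumes x: "x \<in> paths X" and y: "y \<in> paths X"
    and eq: "\<And>a. a \<in> mor_to B (F X) \<Longrightarrow> val x a = val y a"
  shows "x = y"
proof (rule prod_eqI)
  show "fst x = fst y" using x y by simp
  show "snd x = snd y"
  proof (rule extensionalityI)
    show "snd x \<in> extensional (Mor (slice B (F X)))" "snd y \<in> extensional (Mor (slice B (F X)))"
      using x y unfolding paths_to_def by auto
    fix m assume "m \<in> Mor (slice B (F X))"
    then obtain a b where m: "m = (a, b)" "a \<in> mor_to B (F X)" "b \<in> mor_to B (src B a)"
      by (cases m) auto
    moreover have "a \<odot> b \<in> mor_to B (F X)" using m by simp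
    ultimately have "step x a b = step y a b"
      using path_steps[OF x m(2,3)] path_steps[OF y m(2,3)] eq path_at[OF x m(2)] path_at[OF y m(2)]
        factorization_unique(2)[of "val x a" "step x a b" "val y a" "step y a b"] by simp
    then show "snd x m = snd y m"
      using path_steps(6)[OF x m(2,3)] path_steps(6)[OF y m(2,3)] eq m by simp
  qed
qed

text \<open>
  A path through \<open>\<alpha>\<gamma>\<close> passes through \<open>\<alpha>\<close>, because \<open>x(F(\<alpha>)) x\<^sub>2(F(\<alpha>), F(\<gamma>))\<close> and \<open>\<alpha>\<gamma>\<close> are two
  factorizations of the same morphism over the same pair.
\<close>

lemma val_prefix:
  assumes x: "x \<in> paths X" and a: "\<alpha> \<in> mor_to E X" "\<gamma> \<in> mor_to E (src E \<alpha>)"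
    and eq: "val x (F \<alpha> \<odot> F \<gamma>) = \<alpha> \<cdot> \<gamma>"
  shows "val x (F \<alpha>) = \<alpha>" "step x (F \<alpha>) (F \<gamma>) = \<gamma>"
proof -
  have m: "\<alpha> \<in> Mor E" "F \<alpha> \<in> mor_to B (F X)" "F \<gamma> \<in> mor_to B (src B (F \<alpha>))"
    using a F_mor_to_src[of \<alpha> \<gamma>] by auto
  note s = path_steps[OF x m(2,3)] path_at[OF x m(2)]
  show "val x (F \<alpha>) = \<alpha>" "step x (F \<alpha>) (F \<gamma>) = \<gamma>"
    using factorization_unique[of "val x (F \<alpha>)" "step x (F \<alpha>) (F \<gamma>)" \<alpha> \<gamma>] s m a eq by simp_all
qed

lemma val_agree:
  assumes x: "x \<in> paths X" and y: "y \<in> paths X"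
    and ab: "a \<in> mor_to B (F X)" "b \<in> mor_to B (src B a)"
    and eq: "val x (a \<odot> b) = val y (a \<odot> b)"
  shows "val x a = val y a"
  using val_prefix(1)[OF x path_steps(1,3)[OF y ab]] path_steps[OF y ab] eq by simp

lemma cylD:
  assumes "x \<in> Z \<mu>"
  shows "x \<in> paths (rng E \<mu>)" "val x (F \<mu>) = \<mu>"
  using assms unfolding cyl_def by auto

section \<open>Restriction and concatenation\<close>

text \<open>
  Recasting the restriction of \<open>x\<close> as the path of the thread \<open>a \<mapsto> x\<^sub>2(F(\<mu>), a)\<close> reduces its
  functoriality to the correspondence between threads and paths.
\<close>

lemma res_path:
  assumes \<mu>: "\<mu> \<in> Mor E" and x: "x \<in> Z \<mu>"
  shows "thread (src E \<mu>) (step x (F \<mu>))" "res E B F \<mu> x = path_of (src E \<mu>) (step x (F \<mu>))"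
proof -
  note px = cylD[OF x]
  have t: "thread (rng E \<mu>) (val x)" using thread_at[OF px(1)] .
  have m: "F \<mu> \<in> mor_to B (F (rng E \<mu>))" "F \<mu> \<in> Mor B" using \<mu> by simp_all
  have main: "step x (F \<mu>) a \<in> mor_to E (src E \<mu>)" "F (step x (F \<mu>) a) = a"
     "step x (F \<mu> \<odot> a) b \<in> mor_to E (src E (step x (F \<mu>) a))" "F (step x (F \<mu> \<odot> a) b) = b"
     "step x (F \<mu>) (a \<odot> b) = step x (F \<mu>) a \<cdot> step x (F \<mu> \<odot> a) b"
    if a: "a \<in> mor_to B (src B (F \<mu>))" and b: "b \<in> mor_to B (src B a)" for a b
  proof -
    have ma: "a \<in> Mor B" "F \<mu> \<odot> a \<in> mor_to B (F (rng E \<mu>))" "src B (F \<mu> \<odot> a) = src B a"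
      "a \<odot> b \<in> mor_to B (src B (F \<mu>))"
      using a b m by auto
    note s1 = path_steps[OF px(1) m(1) a]
    show s: "step x (F \<mu>) a \<in> mor_to E (src E \<mu>)" "F (step x (F \<mu>) a) = a"
      using s1 px(2) by simp_all
    have "val x (F \<mu> \<odot> a) = \<mu> \<cdot> step x (F \<mu>) a" using s1 px(2) by simp
    then have "src E (val x (F \<mu> \<odot> a)) = src E (step x (F \<mu>) a)" using s \<mu> by simp
    then show "step x (F \<mu> \<odot> a) b \<in> mor_to E (src E (step x (F \<mu>) a))" "F (step x (F \<mu> \<odot> a) b) = b"
      using path_steps(3,4)[OF px(1) ma(2), of b] b ma by simp_all
    show "step x (F \<mu>) (a \<odot> b) = step x (F \<mu>) a \<cdot> step x (F \<mu> \<odot> a) b"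
      using next_step_comp[OF t m(1) a b] step_eq_next_step[OF px(1)] m(1) a b ma by simp
  qed
  have main1: "step x (F \<mu>) a \<in> mor_to E (src E \<mu>)" "F (step x (F \<mu>) a) = a"
    if a: "a \<in> mor_to B (src B (F \<mu>))" for a
    using main(1,2)[OF a B.src_in_mor_to] a by auto
  have "\<exists>\<gamma>\<in>mor_to E (src E (step x (F \<mu>) a)). F \<gamma> = b \<and> step x (F \<mu>) (a \<odot> b) = step x (F \<mu>) a \<cdot> \<gamma>"
    if a: "a \<in> mor_to B (src B (F \<mu>))" and b: "b \<in> mor_to B (src B a)" for a b
    using main(3-5)[OF that] by (intro bexI[of _ "step x (F \<mu> \<odot> a) b"]) auto
  then show "thread (src E \<mu>) (step x (F \<mu>))"
    unfolding thread_def using main1 \<mu> by simp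
  have "next_step (step x (F \<mu>)) a b = step x (F \<mu> \<odot> a) b"
    if a: "a \<in> mor_to B (src B (F \<mu>))" and b: "b \<in> mor_to B (src B a)" for a b
    using main[OF that] by (intro next_step_unique) auto
  then show "res E B F \<mu> x = path_of (src E \<mu>) (step x (F \<mu>))"
    using \<mu> unfolding res_def path_of_def by (auto intro!: restrict_ext)
qed

lemma res_in_paths:
  assumes "\<mu> \<in> Mor E" "x \<in> Z \<mu>"
  shows "res E B F \<mu> x \<in> paths (src E \<mu>)"
  using res_path[OF assms] path_of_in_paths assms(1) by simp

lemma val_res:
  assumes \<mu>: "\<mu> \<in> Mor E" and x: "x \<in> Z \<mu>" and a: "a \<in> mor_to B (src B (F \<mu>))"
  shows "val (res E B F \<mu> x) a = step x (F \<mu>) a"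
  using res_path(2)[OF \<mu> x] at_path_of \<mu> a by simp

lemma comp_val_res:
  assumes \<mu>: "\<mu> \<in> Mor E" and x: "x \<in> Z \<mu>" and a: "a \<in> mor_to B (src B (F \<mu>))"
  shows "\<mu> \<cdot> val (res E B F \<mu> x) a = val x (F \<mu> \<odot> a)"
proof -
  have "F \<mu> \<in> mor_to B (F (rng E \<mu>))" using \<mu> by simp
  then show ?thesis
    using path_steps(5)[OF cylD(1)[OF x] _ a] cylD(2)[OF x] val_res[OF assms] by simp
qed

text \<open>
  Restriction deletes the prefix \<open>\<mu>\<close>; by unique factorization this determines it.
\<close>

lemma res_eqI:
  assumes \<mu>: "\<mu> \<in> Mor E" and x: "x \<in> Z \<mu>" and z: "z \<in> paths (src E \<mu>)"
    and eq: "\<And>a. a \<in> mor_to B (src B (F \<mu>)) \<Longrightarrow> \<mu> \<cdot> val z a = val x (F \<mu> \<odot> a)"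
  shows "res E B F \<mu> x = z"
proof (rule path_eqI[OF res_in_paths[OF \<mu> x] z])
  fix a assume a: "a \<in> mor_to B (F (src E \<mu>))"
  then have a': "a \<in> mor_to B (src B (F \<mu>))" using \<mu> by simp
  show "val (res E B F \<mu> x) a = val z a"
    using factorization_unique(2)[OF \<mu> _ \<mu>, of "val (res E B F \<mu> x) a" "val z a"]
      path_at[OF res_in_paths[OF \<mu> x] a] path_at[OF z a] comp_val_res[OF \<mu> x a'] eq[OF a'] by simp
qed

text \<open>
  The restriction of \<open>x\<close> only records the values \<open>x(F(\<mu>)q)\<close>.  By the Ore condition every \<open>a\<close> has an
  extension of the form \<open>F(\<mu>)q\<close>, and \<open>x(a)\<close> is the prefix of \<open>x(F(\<mu>)q)\<close>.
\<close>

lemma res_inj: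
  assumes \<mu>: "\<mu> \<in> Mor E" and x: "x \<in> Z \<mu>" and y: "y \<in> Z \<mu>"
    and eq: "res E B F \<mu> x = res E B F \<mu> y"
  shows "x = y"
proof (rule path_eqI[OF cylD(1)[OF x] cylD(1)[OF y]])
  fix a assume a: "a \<in> mor_to B (F (rng E \<mu>))"
  have m: "F \<mu> \<in> mor_to B (F (rng E \<mu>))" using \<mu> by simp
  obtain p q where pq: "p \<in> mor_to B (src B a)" "q \<in> mor_to B (src B (F \<mu>))" "a \<odot> p = F \<mu> \<odot> q"
    using ore[OF a m] by blast
  then have "val x (a \<odot> p) = val y (a \<odot> p)"
    using comp_val_res[OF \<mu> x pq(2)] comp_val_res[OF \<mu> y pq(2)] eq by simp
  then show "val x a = val y a"
    by (rule val_agree[OF cylD(1)[OF x] cylD(1)[OF y] a pq(1)])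
qed

text \<open>
  The morphisms that the concatenation of \<open>\<mu>\<close> with the path \<open>z\<close> must pass through: the prefixes of
  the morphisms \<open>\<mu> z(a)\<close>.
\<close>

definition initial :: "'e \<Rightarrow> ('e, 'b) path \<Rightarrow> 'e \<Rightarrow> bool" where
  "initial \<mu> z \<alpha> \<longleftrightarrow> \<alpha> \<in> mor_to E (rng E \<mu>) \<and>
    (\<exists>a\<in>mor_to B (src B (F \<mu>)). \<exists>\<delta>\<in>mor_to E (src E \<alpha>). \<mu> \<cdot> val z a = \<alpha> \<cdot> \<delta>)"

text \<open>
  Two prefixes \<open>\<alpha>\<^sub>1, \<alpha>\<^sub>2\<close> over the same \<open>b\<close> come with \<open>F(\<mu>)a\<^sub>i = b q\<^sub>i\<close>.  These are two completions of
  the cospan of \<open>F(\<mu>)\<close> and \<open>b\<close>, and the strong Ore condition makes them agree further out: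
  \<open>a\<^sub>1c\<^sub>1 = a\<^sub>2c\<^sub>2\<close> and \<open>q\<^sub>1c\<^sub>1 = q\<^sub>2c\<^sub>2\<close>.  Then both are the prefix of the single morphism \<open>\<mu> z(a\<^sub>1c\<^sub>1)\<close>
  for the same factorization of its image, hence equal.
\<close>

lemma initial_unique:
  assumes \<mu>: "\<mu> \<in> Mor E" and z: "z \<in> paths (src E \<mu>)"
    and i: "initial \<mu> z \<alpha>\<^sub>1" "initial \<mu> z \<alpha>\<^sub>2" and eq: "F \<alpha>\<^sub>1 = F \<alpha>\<^sub>2"
  shows "\<alpha>\<^sub>1 = \<alpha>\<^sub>2"
proof -
  obtain a\<^sub>1 \<delta>\<^sub>1 where 1: "\<alpha>\<^sub>1 \<in> mor_to E (rng E \<mu>)" "a\<^sub>1 \<in> mor_to B (src B (F \<mu>))"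
    "\<delta>\<^sub>1 \<in> mor_to E (src E \<alpha>\<^sub>1)" "\<mu> \<cdot> val z a\<^sub>1 = \<alpha>\<^sub>1 \<cdot> \<delta>\<^sub>1"
    using i(1) unfolding initial_def by blast
  obtain a\<^sub>2 \<delta>\<^sub>2 where 2: "\<alpha>\<^sub>2 \<in> mor_to E (rng E \<mu>)" "a\<^sub>2 \<in> mor_to B (src B (F \<mu>))"
    "\<delta>\<^sub>2 \<in> mor_to E (src E \<alpha>\<^sub>2)" "\<mu> \<cdot> val z a\<^sub>2 = \<alpha>\<^sub>2 \<cdot> \<delta>\<^sub>2"
    using i(2) unfolding initial_def by blast
  \<comment> \<open>A prefix of \<open>\<mu> z(a)\<close> remains a prefix of \<open>\<mu> z(ac)\<close> for every \<open>c\<close>.\<close>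
  have prefix: "F \<mu> \<odot> a = F \<alpha> \<odot> F \<delta>" "F \<delta> \<in> mor_to B (src B (F \<alpha>))"
    "\<And>c. c \<in> mor_to B (src B a) \<Longrightarrow> \<exists>\<epsilon>\<in>mor_to E (src E \<alpha>). F \<epsilon> = F \<delta> \<odot> c \<and> \<mu> \<cdot> val z (a \<odot> c) = \<alpha> \<cdot> \<epsilon>"
    if h: "\<alpha> \<in> mor_to E (rng E \<mu>)" "a \<in> mor_to B (src B (F \<mu>))"
    "\<delta> \<in> mor_to E (src E \<alpha>)" "\<mu> \<cdot> val z a = \<alpha> \<cdot> \<delta>" for \<alpha> a \<delta>
  proof -
    have a: "a \<in> mor_to B (F (src E \<mu>))" using h(2) \<mu> by simp
    have m: "\<alpha> \<in> Mor E" "\<delta> \<in> Mor E" using h by auto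
    note za = path_at[OF z a]
    show "F \<mu> \<odot> a = F \<alpha> \<odot> F \<delta>"
      using arg_cong[OF h(4), of F] za h(1-3) \<mu> m by simp
    show "F \<delta> \<in> mor_to B (src B (F \<alpha>))" using F_mor_to_src h m by simp
    fix c assume c: "c \<in> mor_to B (src B a)"
    note s = path_steps[OF z a c]
    have "src E (val z a) = src E \<delta>"
      using arg_cong[OF h(4), of "src E"] za h(1-3) \<mu> m by simp
    then have sd: "step z a c \<in> mor_to E (src E \<delta>)" using s by simp
    have "\<mu> \<cdot> val z (a \<odot> c) = (\<mu> \<cdot> val z a) \<cdot> step z a c"
      using s za \<mu> by (simp add: E.comp_assoc)
    also have "\<dots> = \<alpha> \<cdot> (\<delta> \<cdot> step z a c)"
      using h sd m by (simp add: E.comp_assoc)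
    finally show "\<exists>\<epsilon>\<in>mor_to E (src E \<alpha>). F \<epsilon> = F \<delta> \<odot> c \<and> \<mu> \<cdot> val z (a \<odot> c) = \<alpha> \<cdot> \<epsilon>"
      using h sd m s by (intro bexI[of _ "\<delta> \<cdot> step z a c"]) auto
  qed
  note p1 = prefix[OF 1] and p2 = prefix[OF 2]
  have m: "F \<mu> \<in> mor_to B (F (rng E \<mu>))" "F \<alpha>\<^sub>2 \<in> mor_to B (F (rng E \<mu>))"
    using \<mu> F_mor_to[OF 2(1)] by simp_all
  obtain c\<^sub>1 c\<^sub>2 where c: "c\<^sub>1 \<in> mor_to B (src B a\<^sub>1)" "c\<^sub>2 \<in> mor_to B (src B a\<^sub>2)"
    "a\<^sub>1 \<odot> c\<^sub>1 = a\<^sub>2 \<odot> c\<^sub>2" "F \<delta>\<^sub>1 \<odot> c\<^sub>1 = F \<delta>\<^sub>2 \<odot> c\<^sub>2"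
    using ore_strong[OF m 1(2) 2(2), of "F \<delta>\<^sub>1" "F \<delta>\<^sub>2"] p1(1,2) p2(1,2) eq by metis
  obtain \<epsilon>\<^sub>1 where e1: "\<epsilon>\<^sub>1 \<in> mor_to E (src E \<alpha>\<^sub>1)" "F \<epsilon>\<^sub>1 = F \<delta>\<^sub>1 \<odot> c\<^sub>1" "\<mu> \<cdot> val z (a\<^sub>1 \<odot> c\<^sub>1) = \<alpha>\<^sub>1 \<cdot> \<epsilon>\<^sub>1"
    using p1(3)[OF c(1)] by blast
  obtain \<epsilon>\<^sub>2 where e2: "\<epsilon>\<^sub>2 \<in> mor_to E (src E \<alpha>\<^sub>2)" "F \<epsilon>\<^sub>2 = F \<delta>\<^sub>2 \<odot> c\<^sub>2" "\<mu> \<cdot> val z (a\<^sub>2 \<odot> c\<^sub>2) = \<alpha>\<^sub>2 \<cdot> \<epsilon>\<^sub>2"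
    using p2(3)[OF c(2)] by blast
  have "\<alpha>\<^sub>1 \<in> Mor E" "\<alpha>\<^sub>2 \<in> Mor E" using 1(1) 2(1) by auto
  then show ?thesis
    using factorization_unique(1)[of \<alpha>\<^sub>1 \<epsilon>\<^sub>1 \<alpha>\<^sub>2 \<epsilon>\<^sub>2] e1 e2 c eq by simp
qed

text \<open>
  The preimage is the concatenation of \<open>\<mu>\<close> and \<open>z\<close>: over each \<open>b\<close> it takes the prefix of some
  \<open>\<mu> z(a)\<close>.  Such a prefix exists because, by the Ore condition, \<open>b\<close> extends to some \<open>F(\<mu>)p\<close>.
\<close>

lemma res_surj:
  assumes \<mu>: "\<mu> \<in> Mor E" and z: "z \<in> paths (src E \<mu>)"
  obtains y where "y \<in> Z \<mu>" "res E B F \<mu> y = z"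
proof -
  define f where "f b = (THE \<alpha>. initial \<mu> z \<alpha> \<and> F \<alpha> = b)" for b
  have f_eq: "f b = \<alpha>" if "initial \<mu> z \<alpha>" "F \<alpha> = b" for b \<alpha>
    unfolding f_def using that initial_unique[OF \<mu> z] by (intro the_equality) auto
  have val_mor: "val z a \<in> mor_to E (src E \<mu>)" "val z a \<in> Mor E" "F (val z a) = a"
    if "a \<in> mor_to B (src B (F \<mu>))" for a
    using path_at[OF z, of a] that \<mu> by simp_all
  have f: "initial \<mu> z (f b) \<and> F (f b) = b" if b: "b \<in> mor_to B (F (rng E \<mu>))" for b
  proof -
    have "F \<mu> \<in> mor_to B (F (rng E \<mu>))" using \<mu> by simp
    from ore[OF this b] obtain p q where pq: "p \<in> mor_to B (src B (F \<mu>))"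
      "q \<in> mor_to B (src B b)" "F \<mu> \<odot> p = b \<odot> q" by blast
    note zp = val_mor[OF pq(1)]
    have "\<mu> \<cdot> val z p \<in> Mor E" "F (\<mu> \<cdot> val z p) = b \<odot> q" "b \<in> Mor B"
      using zp \<mu> pq b by auto
    then obtain \<alpha> \<gamma> where \<alpha>: "\<alpha> \<in> mor_to E (rng E (\<mu> \<cdot> val z p))" "\<gamma> \<in> mor_to E (src E \<alpha>)"
      "\<mu> \<cdot> val z p = \<alpha> \<cdot> \<gamma>" "F \<alpha> = b" "F \<gamma> = q"
      using factorization pq(2) by metis
    have "\<alpha> \<in> mor_to E (rng E \<mu>)" using \<alpha>(1) zp \<mu> by simp
    then have "initial \<mu> z \<alpha>" unfolding initial_def using \<alpha>(2,3) pq(1) by blast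
    then show ?thesis using f_eq \<alpha>(4) by auto
  qed
  have f_mor: "f b \<in> mor_to E (rng E \<mu>)" if b: "b \<in> mor_to B (F (rng E \<mu>))" for b
    using f[OF b] unfolding initial_def by blast
  have t: "thread (rng E \<mu>) f"
    unfolding thread_def
  proof (intro ballI conjI)
    fix b assume b: "b \<in> mor_to B (F (rng E \<mu>))"
    show "f b \<in> mor_to E (rng E \<mu>)" "F (f b) = b" using f_mor f b by simp_all
    fix c assume c: "c \<in> mor_to B (src B b)"
    have bc: "b \<odot> c \<in> mor_to B (F (rng E \<mu>))" "b \<in> Mor B" using b c by auto
    note fbc = f_mor[OF bc(1)] f[OF bc(1)]
    have "f (b \<odot> c) \<in> Mor E" "F (f (b \<odot> c)) = b \<odot> c" using fbc by auto
    from factorization[OF this(1) bc(2) c this(2)]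
    obtain \<alpha> \<gamma> where \<alpha>: "\<alpha> \<in> mor_to E (rng E (f (b \<odot> c)))" "\<gamma> \<in> mor_to E (src E \<alpha>)"
      "f (b \<odot> c) = \<alpha> \<cdot> \<gamma>" "F \<alpha> = b" "F \<gamma> = c" by blast
    have am: "\<alpha> \<in> Mor E" "\<gamma> \<in> Mor E" "\<alpha> \<in> mor_to E (rng E \<mu>)" using \<alpha>(1,2) fbc(1) by auto
    \<comment> \<open>Prefixes of prefixes are prefixes, so the factor over \<open>b\<close> of \<open>f(bc)\<close> is \<open>f(b)\<close>.\<close>
    obtain a \<delta> where a: "a \<in> mor_to B (src B (F \<mu>))" "\<delta> \<in> mor_to E (src E (f (b \<odot> c)))"
      "\<mu> \<cdot> val z a = f (b \<odot> c) \<cdot> \<delta>"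
      using fbc(2) unfolding initial_def by blast
    have "\<delta> \<in> mor_to E (src E \<gamma>)" using a(2) \<alpha> am by simp
    moreover from this have "\<mu> \<cdot> val z a = \<alpha> \<cdot> (\<gamma> \<cdot> \<delta>)" using a(3) \<alpha> am by (simp add: E.comp_assoc)
    ultimately have "initial \<mu> z \<alpha>"
      unfolding initial_def using a(1) \<alpha>(2) am by (intro conjI bexI[of _ a] bexI[of _ "\<gamma> \<cdot> \<delta>"]) auto
    then have "f b = \<alpha>" using f_eq \<alpha>(4) by simp
    then show "\<exists>\<gamma>\<in>mor_to E (src E (f b)). F \<gamma> = c \<and> f (b \<odot> c) = f b \<cdot> \<gamma>"
      using \<alpha> by blast
  qed
  have f_comp: "f (F \<mu> \<odot> a) = \<mu> \<cdot> val z a" if a: "a \<in> mor_to B (src B (F \<mu>))" for a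
  proof (rule f_eq)
    note za = val_mor[OF a]
    show "F (\<mu> \<cdot> val z a) = F \<mu> \<odot> a" using za \<mu> by simp
    have "\<mu> \<cdot> val z a \<in> Mor E" "\<mu> \<cdot> val z a \<in> mor_to E (rng E \<mu>)" using za \<mu> by auto
    then show "initial \<mu> z (\<mu> \<cdot> val z a)"
      unfolding initial_def using a
      by (intro conjI bexI[of _ a] bexI[of _ "src E (\<mu> \<cdot> val z a)"]) auto
  qed
  have f_\<mu>: "f (F \<mu>) = \<mu>"
  proof (rule f_eq)
    have "src B (F \<mu>) \<in> mor_to B (src B (F \<mu>))" using \<mu> by simp
    then show "initial \<mu> z \<mu>"
      unfolding initial_def using val_mor(1) E.mor_to_rng[OF \<mu>] by blast
  qed simp
  define y where "y = path_of (rng E \<mu>) f"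
  have val_y: "val y b = f b" if "b \<in> mor_to B (F (rng E \<mu>))" for b
    unfolding y_def using at_path_of that .
  have "y \<in> paths (rng E \<mu>)" unfolding y_def using path_of_in_paths t \<mu> by simp
  then have y: "y \<in> Z \<mu>" unfolding cyl_def using val_y f_\<mu> \<mu> by simp
  have "val y (F \<mu> \<odot> a) = \<mu> \<cdot> val z a" if "a \<in> mor_to B (src B (F \<mu>))" for a
    using val_y f_comp that \<mu> by simp
  then have "res E B F \<mu> y = z" using res_eqI[OF \<mu> y z] by simp
  then show thesis using that y by blast
qed

lemma ind:
  assumes \<mu>: "\<mu> \<in> Mor E" and z: "z \<in> paths (src E \<mu>)"
  shows "ind E B F \<mu> z \<in> Z \<mu>" "res E B F \<mu> (ind E B F \<mu> z) = z"
proof -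
  have "z \<in> res E B F \<mu> ` Z \<mu>" using res_surj[OF assms] by blast
  then show "ind E B F \<mu> z \<in> Z \<mu>" "res E B F \<mu> (ind E B F \<mu> z) = z"
    unfolding ind_def by (auto intro: inv_into_into f_inv_into_f)
qed

lemma ind_eqI:
  assumes "\<mu> \<in> Mor E" "y \<in> Z \<mu>" "res E B F \<mu> y = z"
  shows "ind E B F \<mu> z = y"
proof -
  have "z \<in> paths (src E \<mu>)" using res_in_paths[OF assms(1,2)] assms(3) by simp
  then show ?thesis using res_inj[OF assms(1)] ind[OF assms(1)] assms by metis
qed

section \<open>Germs\<close>

lemma Z_comp_iff:
  assumes \<nu>: "\<nu> \<in> Mor E" and l: "\<eta> \<in> mor_to E (src E \<nu>)"
  shows "x \<in> Z (\<nu> \<cdot> \<eta>) \<longleftrightarrow> x \<in> Z \<nu> \<and> res E B F \<nu> x \<in> Z \<eta>"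
proof -
  have m: "\<eta> \<in> Mor E" "rng E \<eta> = src E \<nu>" "F \<eta> \<in> mor_to B (src B (F \<nu>))"
    using l F_mor_to_src[OF \<nu> l] by auto
  have Z: "x \<in> Z (\<nu> \<cdot> \<eta>) \<longleftrightarrow> x \<in> paths (rng E \<nu>) \<and> val x (F \<nu> \<odot> F \<eta>) = \<nu> \<cdot> \<eta>"
    unfolding cyl_def using \<nu> l by simp
  show ?thesis
  proof
    assume x: "x \<in> Z (\<nu> \<cdot> \<eta>)"
    then have "val x (F \<nu>) = \<nu>" "step x (F \<nu>) (F \<eta>) = \<eta>"
      using val_prefix[of x "rng E \<nu>" \<nu> \<eta>] Z \<nu> l by simp_all
    moreover from this have xn: "x \<in> Z \<nu>" using x Z unfolding cyl_def by simp
    ultimately show "x \<in> Z \<nu> \<and> res E B F \<nu> x \<in> Z \<eta>"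
      using val_res[OF \<nu> xn m(3)] res_in_paths[OF \<nu> xn] m(2) unfolding cyl_def[of E B F \<eta>] by simp
  next
    assume "x \<in> Z \<nu> \<and> res E B F \<nu> x \<in> Z \<eta>"
    then show "x \<in> Z (\<nu> \<cdot> \<eta>)"
      using comp_val_res[OF \<nu> _ m(3), of x] cylD[of x \<nu>] cylD[of "res E B F \<nu> x" \<eta>] Z by simp
  qed
qed

lemma res_comp:
  assumes \<nu>: "\<nu> \<in> Mor E" and l: "\<eta> \<in> mor_to E (src E \<nu>)" and x: "x \<in> Z (\<nu> \<cdot> \<eta>)"
  shows "res E B F (\<nu> \<cdot> \<eta>) x = res E B F \<eta> (res E B F \<nu> x)"
proof (rule res_eqI)
  have m: "\<eta> \<in> Mor E" "rng E \<eta> = src E \<nu>" "F \<eta> \<in> mor_to B (src B (F \<nu>))"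
    using l F_mor_to_src[OF \<nu> l] by auto
  have xn: "x \<in> Z \<nu>" and xl: "res E B F \<nu> x \<in> Z \<eta>" using Z_comp_iff[OF \<nu> l] x by simp_all
  show "\<nu> \<cdot> \<eta> \<in> Mor E" "x \<in> Z (\<nu> \<cdot> \<eta>)" using \<nu> l x by simp_all
  show p: "res E B F \<eta> (res E B F \<nu> x) \<in> paths (src E (\<nu> \<cdot> \<eta>))"
    using res_in_paths[OF m(1) xl] \<nu> l by simp
  fix a assume "a \<in> mor_to B (src B (F (\<nu> \<cdot> \<eta>)))"
  then have a: "a \<in> mor_to B (src B (F \<eta>))" using \<nu> l m by simp
  have la: "F \<eta> \<odot> a \<in> mor_to B (src B (F \<nu>))" using a m by simp
  have "val (res E B F \<eta> (res E B F \<nu> x)) a \<in> mor_to E (src E \<eta>)"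
    using path_at(1)[OF res_in_paths[OF m(1) xl]] a m by simp
  then have "\<nu> \<cdot> \<eta> \<cdot> val (res E B F \<eta> (res E B F \<nu> x)) a = \<nu> \<cdot> val (res E B F \<nu> x) (F \<eta> \<odot> a)"
    using comp_val_res[OF m(1) xl a] E.comp_assoc[OF \<nu> l] by simp
  also have "\<dots> = val x (F \<nu> \<odot> (F \<eta> \<odot> a))" using comp_val_res[OF \<nu> xn la] .
  finally show "\<nu> \<cdot> \<eta> \<cdot> val (res E B F \<eta> (res E B F \<nu> x)) a = val x (F (\<nu> \<cdot> \<eta>) \<odot> a)"
    using B.comp_assoc[of "F \<nu>" "F \<eta>" a] \<nu> l m a by simp
qed

lemma Z_comp_subset:
  assumes "\<nu> \<in> Mor E" "\<eta> \<in> mor_to E (src E \<nu>)"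
  shows "Z (\<nu> \<cdot> \<eta>) \<subseteq> Z \<nu>"
  using Z_comp_iff[OF assms] by blast

text \<open>
  A path through \<open>\<nu>\<close> can be followed further along any \<open>c\<close>.
\<close>

lemma Z_extend:
  assumes \<nu>: "\<nu> \<in> Mor E" and x: "x \<in> Z \<nu>" and c: "c \<in> mor_to B (src B (F \<nu>))"
  obtains \<eta> where "\<eta> \<in> mor_to E (src E \<nu>)" "F \<eta> = c" "x \<in> Z (\<nu> \<cdot> \<eta>)"
proof -
  have m: "F \<nu> \<in> mor_to B (F (rng E \<nu>))" using \<nu> by simp
  note s = path_steps[OF cylD(1)[OF x] m c]
  have "step x (F \<nu>) c \<in> mor_to E (src E \<nu>)" using s(3) cylD(2)[OF x] by simp
  moreover from this have "x \<in> Z (\<nu> \<cdot> step x (F \<nu>) c)"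
    using s \<nu> cylD[OF x] unfolding cyl_def by simp
  ultimately show thesis using that s(4) by blast
qed

text \<open>
  The cylinders contained in \<open>Z(\<nu>)\<close> that prolong \<open>\<nu>\<close> form a neighbourhood base of \<open>x\<close>: by the Ore
  condition \<open>F(\<nu>)p = F(\<kappa>)q\<close> for some \<open>p, q\<close>, and the value of \<open>x\<close> there prolongs both \<open>\<nu>\<close> and \<open>\<kappa>\<close>.
\<close>

lemma Z_refine:
  assumes \<nu>: "\<nu> \<in> Mor E" and \<kappa>: "\<kappa> \<in> Mor E" and x: "x \<in> Z \<nu>" "x \<in> Z \<kappa>"
  obtains \<eta> where "\<eta> \<in> mor_to E (src E \<nu>)" "x \<in> Z (\<nu> \<cdot> \<eta>)" "Z (\<nu> \<cdot> \<eta>) \<subseteq> Z \<kappa>"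
proof -
  have r: "rng E \<kappa> = rng E \<nu>" using fst_path[OF cylD(1)[OF x(1)]] fst_path[OF cylD(1)[OF x(2)]] by simp
  have m: "F \<nu> \<in> mor_to B (F (rng E \<nu>))" "F \<kappa> \<in> mor_to B (F (rng E \<nu>))"
    using \<nu> F_mor_to[OF E.mor_to_rng[OF \<kappa>]] r by simp_all
  obtain p q where pq: "p \<in> mor_to B (src B (F \<nu>))" "q \<in> mor_to B (src B (F \<kappa>))" "F \<nu> \<odot> p = F \<kappa> \<odot> q"
    using ore[OF m] by blast
  obtain \<eta> where l: "\<eta> \<in> mor_to E (src E \<nu>)" "F \<eta> = p" "x \<in> Z (\<nu> \<cdot> \<eta>)" using Z_extend[OF \<nu> x(1) pq(1)] by blast
  obtain \<eta>' where l': "\<eta>' \<in> mor_to E (src E \<kappa>)" "F \<eta>' = q" "x \<in> Z (\<kappa> \<cdot> \<eta>')" using Z_extend[OF \<kappa> x(2) pq(2)] by blast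
  have "\<nu> \<cdot> \<eta> = val x (F (\<nu> \<cdot> \<eta>))" using cylD(2)[OF l(3)] by simp
  also have "F (\<nu> \<cdot> \<eta>) = F (\<kappa> \<cdot> \<eta>')" using pq l l' \<nu> \<kappa> by simp
  also have "val x (F (\<kappa> \<cdot> \<eta>')) = \<kappa> \<cdot> \<eta>'" using cylD(2)[OF l'(3)] by simp
  finally have "Z (\<nu> \<cdot> \<eta>) \<subseteq> Z \<kappa>" using Z_comp_subset[OF \<kappa> l'(1)] by simp
  then show thesis using that l by blast
qed

text \<open>
  Exchanging the prefix \<open>\<nu>\<close> of a path for \<open>\<mu>\<close> also exchanges the prefix \<open>\<nu>\<eta>\<close> for \<open>\<mu>\<eta>\<close>.
\<close>

lemma ind_res_comp:
  assumes \<mu>: "\<mu> \<in> Mor E" and \<nu>: "\<nu> \<in> Mor E" and s: "src E \<mu> = src E \<nu>"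
    and l: "\<eta> \<in> mor_to E (src E \<nu>)" and y: "y \<in> Z (\<nu> \<cdot> \<eta>)"
  shows "ind E B F (\<mu> \<cdot> \<eta>) (res E B F (\<nu> \<cdot> \<eta>) y) = ind E B F \<mu> (res E B F \<nu> y)"
proof -
  have l\<mu>: "\<eta> \<in> mor_to E (src E \<mu>)" "\<eta> \<in> Mor E" using l s by auto
  have yn: "y \<in> Z \<nu>" "res E B F \<nu> y \<in> Z \<eta>" using Z_comp_iff[OF \<nu> l] y by simp_all
  define w where "w = ind E B F \<mu> (res E B F \<nu> y)"
  have w: "w \<in> Z \<mu>" "res E B F \<mu> w = res E B F \<nu> y"
    unfolding w_def using ind[OF \<mu>] res_in_paths[OF \<nu> yn(1)] s by simp_all
  then have wl: "w \<in> Z (\<mu> \<cdot> \<eta>)" using Z_comp_iff[OF \<mu> l\<mu>(1)] yn by simp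
  have "res E B F (\<mu> \<cdot> \<eta>) w = res E B F (\<nu> \<cdot> \<eta>) y"
    using res_comp[OF \<mu> l\<mu>(1) wl] res_comp[OF \<nu> l y] w by simp
  then show ?thesis unfolding w_def[symmetric] using ind_eqI wl \<mu> l\<mu> by simp
qed

abbreviation spans where "spans \<equiv> is_span E"

lemma spanD:
  assumes "spans \<mu> \<nu>"
  shows "\<mu> \<in> Mor E" "\<nu> \<in> Mor E" "src E \<mu> = src E \<nu>" "src B (F \<mu>) = src B (F \<nu>)"
  using assms F_simps(2)[of \<mu>] F_simps(2)[of \<nu>] unfolding is_span_def by auto

lemma span_comp: "spans \<mu> \<nu> \<Longrightarrow> \<eta> \<in> mor_to E (src E \<nu>) \<Longrightarrow> spans (\<mu> \<cdot> \<eta>) (\<nu> \<cdot> \<eta>)"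
  unfolding is_span_def by simp

lemma triples_iff: "(\<mu>, \<nu>, x) \<in> triples E B F \<longleftrightarrow> spans \<mu> \<nu> \<and> x \<in> Z \<nu>"
  using cyl_subset_inf_paths[OF E.category, of \<nu>] unfolding triples_def is_span_def by auto

text \<open>
  The two conditions under which triples with the same path have the same germ.  The first is local
  in the path; the second, \<open>same_degree\<close>, does not involve the path at all.
\<close>

definition locally_equal :: "'e \<Rightarrow> 'e \<Rightarrow> 'e \<Rightarrow> 'e \<Rightarrow> ('e, 'b) path \<Rightarrow> bool" where
  "locally_equal \<mu> \<nu> \<mu>' \<nu>' x \<longleftrightarrow>
    (\<exists>\<kappa>\<in>Mor E. x \<in> Z \<kappa> \<and> Z \<kappa> \<subseteq> Z \<nu> \<inter> Z \<nu>' \<and>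
      (\<forall>y\<in>Z \<kappa>. ind E B F \<mu> (res E B F \<nu> y) = ind E B F \<mu>' (res E B F \<nu>' y)))"

definition same_degree :: "'e \<Rightarrow> 'e \<Rightarrow> 'e \<Rightarrow> 'e \<Rightarrow> bool" where
  "same_degree \<mu> \<nu> \<mu>' \<nu>' \<longleftrightarrow>
    (\<exists>a\<in>mor_to B (src B (F \<mu>)). \<exists>b\<in>mor_to B (src B (F \<mu>')).
          F \<mu> \<odot> a = F \<mu>' \<odot> b \<and> F \<nu> \<odot> a = F \<nu>' \<odot> b)"

lemma germ_rel_iff:
  "((\<mu>, \<nu>, x), (\<mu>', \<nu>', x')) \<in> germ_rel E B F \<longleftrightarrow>
    spans \<mu> \<nu> \<and> x \<in> Z \<nu> \<and> spans \<mu>' \<nu>' \<and> x' \<in> Z \<nu>' \<and> x = x' \<and>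
    locally_equal \<mu> \<nu> \<mu>' \<nu>' x \<and> same_degree \<mu> \<nu> \<mu>' \<nu>'"
  unfolding germ_rel_def locally_equal_def same_degree_def by (auto simp: triples_iff)

text \<open>
  Given \<open>a, b\<close> for the first pair and \<open>c, e\<close> for the second, \<open>b\<close> and \<open>c\<close> form a cospan; an Ore
  completion \<open>bp = cq\<close> yields the witnesses \<open>ap, eq\<close>.
\<close>

lemma same_degree_trans:
  assumes s: "spans \<mu>\<^sub>1 \<nu>\<^sub>1" "spans \<mu>\<^sub>2 \<nu>\<^sub>2" "spans \<mu>\<^sub>3 \<nu>\<^sub>3"
    and d: "same_degree \<mu>\<^sub>1 \<nu>\<^sub>1 \<mu>\<^sub>2 \<nu>\<^sub>2" "same_degree \<mu>\<^sub>2 \<nu>\<^sub>2 \<mu>\<^sub>3 \<nu>\<^sub>3"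
  shows "same_degree \<mu>\<^sub>1 \<nu>\<^sub>1 \<mu>\<^sub>3 \<nu>\<^sub>3"
proof -
  note S = spanD[OF s(1)] spanD[OF s(2)] spanD[OF s(3)]
  obtain a b where ab: "a \<in> mor_to B (src B (F \<mu>\<^sub>1))" "b \<in> mor_to B (src B (F \<mu>\<^sub>2))"
    "F \<mu>\<^sub>1 \<odot> a = F \<mu>\<^sub>2 \<odot> b" "F \<nu>\<^sub>1 \<odot> a = F \<nu>\<^sub>2 \<odot> b" using d(1) unfolding same_degree_def by blast
  obtain c e where ce: "c \<in> mor_to B (src B (F \<mu>\<^sub>2))" "e \<in> mor_to B (src B (F \<mu>\<^sub>3))"
    "F \<mu>\<^sub>2 \<odot> c = F \<mu>\<^sub>3 \<odot> e" "F \<nu>\<^sub>2 \<odot> c = F \<nu>\<^sub>3 \<odot> e" using d(2) unfolding same_degree_def by blast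
  have m: "a \<in> Mor B" "b \<in> Mor B" "c \<in> Mor B" "e \<in> Mor B" using ab ce by auto
  obtain p q where pq: "p \<in> mor_to B (src B b)" "q \<in> mor_to B (src B c)" "b \<odot> p = c \<odot> q"
    using ore[OF ab(2) ce(1)] by blast
  have sb: "src B a = src B b" "src B c = src B e"
    using arg_cong[OF ab(3), of "src B"] arg_cong[OF ce(3), of "src B"] ab(1,2) ce(1,2) S by simp_all
  have "G\<^sub>1 \<odot> (a \<odot> p) = G\<^sub>3 \<odot> (e \<odot> q)"
    if "G\<^sub>1 \<in> Mor B" "G\<^sub>2 \<in> Mor B" "G\<^sub>3 \<in> Mor B" "G\<^sub>1 \<odot> a = G\<^sub>2 \<odot> b" "G\<^sub>2 \<odot> c = G\<^sub>3 \<odot> e"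
      "src B G\<^sub>1 = src B (F \<mu>\<^sub>1)" "src B G\<^sub>2 = src B (F \<mu>\<^sub>2)" "src B G\<^sub>3 = src B (F \<mu>\<^sub>3)" for G\<^sub>1 G\<^sub>2 G\<^sub>3
  proof -
    have "G\<^sub>1 \<odot> (a \<odot> p) = (G\<^sub>1 \<odot> a) \<odot> p"
      using B.comp_assoc[OF that(1), of a p] that(6) ab(1) pq(1) sb(1) by simp
    also have "\<dots> = G\<^sub>2 \<odot> (b \<odot> p)"
      using B.comp_assoc[OF that(2), of b p] that(4,7) ab(2) pq(1) by simp
    also have "\<dots> = (G\<^sub>2 \<odot> c) \<odot> q"
      using B.comp_assoc[OF that(2), of c q] that(7) ce(1) pq(2,3) by simp
    also have "\<dots> = G\<^sub>3 \<odot> (e \<odot> q)"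
      using B.comp_assoc[OF that(3), of e q] that(5,8) ce(2) pq(2) sb(2) by simp
    finally show ?thesis .
  qed
  note key = this
  have "F \<mu>\<^sub>1 \<odot> (a \<odot> p) = F \<mu>\<^sub>3 \<odot> (e \<odot> q)"
    by (rule key[of _ "F \<mu>\<^sub>2"]) (simp_all add: spanD(1)[OF s(1)] spanD(1)[OF s(2)] spanD(1)[OF s(3)] ab(3) ce(3))
  moreover have "F \<nu>\<^sub>1 \<odot> (a \<odot> p) = F \<nu>\<^sub>3 \<odot> (e \<odot> q)"
    by (rule key[of _ "F \<nu>\<^sub>2"]) (simp_all add: spanD(2,4)[OF s(1)] spanD(2,4)[OF s(2)] spanD(2,4)[OF s(3)] ab(4) ce(4))
  moreover have "a \<odot> p \<in> mor_to B (src B (F \<mu>\<^sub>1))" "e \<odot> q \<in> mor_to B (src B (F \<mu>\<^sub>3))"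
    using ab ce pq sb by simp_all
  ultimately show ?thesis unfolding same_degree_def by blast
qed

lemma locally_equal_trans:
  assumes l: "locally_equal \<mu>\<^sub>1 \<nu>\<^sub>1 \<mu>\<^sub>2 \<nu>\<^sub>2 x" "locally_equal \<mu>\<^sub>2 \<nu>\<^sub>2 \<mu>\<^sub>3 \<nu>\<^sub>3 x"
  shows "locally_equal \<mu>\<^sub>1 \<nu>\<^sub>1 \<mu>\<^sub>3 \<nu>\<^sub>3 x"
proof -
  obtain \<kappa> where k: "\<kappa> \<in> Mor E" "x \<in> Z \<kappa>" "Z \<kappa> \<subseteq> Z \<nu>\<^sub>1 \<inter> Z \<nu>\<^sub>2"
    "\<forall>y\<in>Z \<kappa>. ind E B F \<mu>\<^sub>1 (res E B F \<nu>\<^sub>1 y) = ind E B F \<mu>\<^sub>2 (res E B F \<nu>\<^sub>2 y)"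
    using l(1) unfolding locally_equal_def by blast
  obtain \<kappa>' where k': "\<kappa>' \<in> Mor E" "x \<in> Z \<kappa>'" "Z \<kappa>' \<subseteq> Z \<nu>\<^sub>2 \<inter> Z \<nu>\<^sub>3"
    "\<forall>y\<in>Z \<kappa>'. ind E B F \<mu>\<^sub>2 (res E B F \<nu>\<^sub>2 y) = ind E B F \<mu>\<^sub>3 (res E B F \<nu>\<^sub>3 y)"
    using l(2) unfolding locally_equal_def by blast
  obtain \<eta> where l: "\<eta> \<in> mor_to E (src E \<kappa>)" "x \<in> Z (\<kappa> \<cdot> \<eta>)" "Z (\<kappa> \<cdot> \<eta>) \<subseteq> Z \<kappa>'"
    using Z_refine[OF k(1) k'(1) k(2) k'(2)] by blast
  have sub: "Z (\<kappa> \<cdot> \<eta>) \<subseteq> Z \<kappa>" using Z_comp_subset[OF k(1) l(1)] .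
  show ?thesis
    unfolding locally_equal_def
  proof (intro bexI conjI ballI)
    show "\<kappa> \<cdot> \<eta> \<in> Mor E" using k(1) l(1) by simp
    show "x \<in> Z (\<kappa> \<cdot> \<eta>)" using l by simp
    show "Z (\<kappa> \<cdot> \<eta>) \<subseteq> Z \<nu>\<^sub>1 \<inter> Z \<nu>\<^sub>3" using sub l(3) k(3) k'(3) by blast
    show "ind E B F \<mu>\<^sub>1 (res E B F \<nu>\<^sub>1 y) = ind E B F \<mu>\<^sub>3 (res E B F \<nu>\<^sub>3 y)" if "y \<in> Z (\<kappa> \<cdot> \<eta>)" for y
      using that sub l(3) k(4) k'(4) by (metis subsetD)
  qed
qed

lemma equiv_germ_rel: "equiv (triples E B F) (germ_rel E B F)"
proof (rule equivI)
  show "germ_rel E B F \<subseteq> triples E B F \<times> triples E B F"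
    unfolding germ_rel_def by auto
  show "refl_on (triples E B F) (germ_rel E B F)"
  proof (rule refl_onI)
    fix t assume t: "t \<in> triples E B F"
    obtain \<mu> \<nu> x where [simp]: "t = (\<mu>, \<nu>, x)" by (cases t)
    have s: "spans \<mu> \<nu>" "x \<in> Z \<nu>" using t by (simp_all add: triples_iff)
    have "F \<mu> \<in> Mor B" using spanD[OF s(1)] by simp
    then have "same_degree \<mu> \<nu> \<mu> \<nu>" unfolding same_degree_def using B.src_in_mor_to by blast
    moreover have "locally_equal \<mu> \<nu> \<mu> \<nu> x"
      unfolding locally_equal_def using s spanD[OF s(1)] by blast
    ultimately show "(t, t) \<in> germ_rel E B F" using s by (simp add: germ_rel_iff)
  qed
  show "sym (germ_rel E B F)"
  proof (rule symI)
    fix t t' assume "(t, t') \<in> germ_rel E B F"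
    moreover obtain \<mu> \<nu> x \<mu>' \<nu>' x' where [simp]: "t = (\<mu>, \<nu>, x)" "t' = (\<mu>', \<nu>', x')"
      by (cases t, cases t')
    moreover have "same_degree \<mu> \<nu> \<mu>' \<nu>' \<Longrightarrow> same_degree \<mu>' \<nu>' \<mu> \<nu>"
      unfolding same_degree_def by metis
    moreover have "locally_equal \<mu> \<nu> \<mu>' \<nu>' x \<Longrightarrow> locally_equal \<mu>' \<nu>' \<mu> \<nu> x"
      unfolding locally_equal_def by (metis Int_commute)
    ultimately show "(t', t) \<in> germ_rel E B F" by (auto simp: germ_rel_iff)
  qed
  show "trans (germ_rel E B F)"
  proof (rule transI)
    fix t\<^sub>1 t\<^sub>2 t\<^sub>3 assume "(t\<^sub>1, t\<^sub>2) \<in> germ_rel E B F" "(t\<^sub>2, t\<^sub>3) \<in> germ_rel E B F"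
    then show "(t\<^sub>1, t\<^sub>3) \<in> germ_rel E B F"
      by (cases t\<^sub>1; cases t\<^sub>2; cases t\<^sub>3)
        (auto simp: germ_rel_iff intro: locally_equal_trans same_degree_trans)
  qed
qed

lemma germ_eq_iff:
  assumes "spans \<mu> \<nu>" "x \<in> Z \<nu>" "spans \<mu>' \<nu>'" "x' \<in> Z \<nu>'"
  shows "germ E B F \<mu> \<nu> x = germ E B F \<mu>' \<nu>' x' \<longleftrightarrow>
    x = x' \<and> locally_equal \<mu> \<nu> \<mu>' \<nu>' x \<and> same_degree \<mu> \<nu> \<mu>' \<nu>'"
  unfolding germ_def using eq_equiv_class_iff[OF equiv_germ_rel, of "(\<mu>, \<nu>, x)" "(\<mu>', \<nu>', x')"] assms
  by (simp add: triples_iff germ_rel_iff)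

text \<open>
  The cylinder \<open>Z(\<nu>\<eta>)\<close> and the pair of \<open>F(\<eta>)\<close> and an identity witness the equivalence.
\<close>

lemma germ_extend:
  assumes s: "spans \<mu> \<nu>" and l: "\<eta> \<in> mor_to E (src E \<nu>)" and x: "x \<in> Z (\<nu> \<cdot> \<eta>)"
  shows "germ E B F (\<mu> \<cdot> \<eta>) (\<nu> \<cdot> \<eta>) x = germ E B F \<mu> \<nu> x"
proof -
  note S = spanD[OF s]
  have sub: "Z (\<nu> \<cdot> \<eta>) \<subseteq> Z \<nu>" using Z_comp_subset[OF S(2) l] .
  have l\<mu>: "\<eta> \<in> mor_to E (src E \<mu>)" "\<eta> \<in> Mor E" using l S by auto
  have "locally_equal (\<mu> \<cdot> \<eta>) (\<nu> \<cdot> \<eta>) \<mu> \<nu> x"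
    unfolding locally_equal_def
    using x sub l S ind_res_comp[OF S(1-3) l] by (intro bexI[of _ "\<nu> \<cdot> \<eta>"]) auto
  moreover have "same_degree (\<mu> \<cdot> \<eta>) (\<nu> \<cdot> \<eta>) \<mu> \<nu>"
    unfolding same_degree_def
  proof (intro bexI conjI)
    show "F \<eta> \<in> mor_to B (src B (F \<mu>))" using F_mor_to_src S(1) l\<mu> by simp
    show "src B (F \<eta>) \<in> mor_to B (src B (F (\<mu> \<cdot> \<eta>)))"
      using l\<mu> S F_mor_to_src[OF S(1) l\<mu>(1)] by simp
    show "F (\<mu> \<cdot> \<eta>) \<odot> src B (F \<eta>) = F \<mu> \<odot> F \<eta>" "F (\<nu> \<cdot> \<eta>) \<odot> src B (F \<eta>) = F \<nu> \<odot> F \<eta>"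
      using l l\<mu> S F_mor_to_src[OF S(1) l\<mu>(1)] F_mor_to_src[OF S(2) l] by simp_all
  qed
  moreover have "x \<in> Z \<nu>" using x sub by blast
  ultimately show ?thesis
    using germ_eq_iff[OF span_comp[OF s l] x s] by simp
qed

lemma germ_cyl_extend:
  assumes "spans \<mu> \<nu>" "\<eta> \<in> mor_to E (src E \<nu>)"
  shows "germ_cyl E B F (\<mu> \<cdot> \<eta>) (\<nu> \<cdot> \<eta>) = germ E B F \<mu> \<nu> ` Z (\<nu> \<cdot> \<eta>)"
  unfolding germ_cyl_def using germ_extend[OF assms] by (intro image_cong) auto

text \<open>
  Coincidence of germs spreads from \<open>x\<close> to nearby paths: the cylinder on which the two local maps
  agree is a neighbourhood of \<open>x\<close>, and \<open>same_degree\<close> holds for all paths or for none.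
\<close>

lemma germ_neighbourhood:
  assumes s: "spans \<mu> \<nu>" "spans \<mu>' \<nu>'" and x: "x \<in> Z \<nu>"
    and g: "germ E B F \<mu> \<nu> x \<in> germ_cyl E B F \<mu>' \<nu>'"
  obtains \<eta> where "\<eta> \<in> mor_to E (src E \<nu>)" "x \<in> Z (\<nu> \<cdot> \<eta>)"
    "germ E B F \<mu> \<nu> ` Z (\<nu> \<cdot> \<eta>) \<subseteq> germ_cyl E B F \<mu>' \<nu>'"
proof -
  obtain x' where x': "x' \<in> Z \<nu>'" "germ E B F \<mu> \<nu> x = germ E B F \<mu>' \<nu>' x'"
    using g unfolding germ_cyl_def by blast
  then have eq: "x = x'" "locally_equal \<mu> \<nu> \<mu>' \<nu>' x" "same_degree \<mu> \<nu> \<mu>' \<nu>'"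
    using germ_eq_iff[OF s(1) x s(2) x'(1)] by blast+
  then obtain \<kappa> where k: "\<kappa> \<in> Mor E" "x \<in> Z \<kappa>" "Z \<kappa> \<subseteq> Z \<nu> \<inter> Z \<nu>'"
    "\<forall>y\<in>Z \<kappa>. ind E B F \<mu> (res E B F \<nu> y) = ind E B F \<mu>' (res E B F \<nu>' y)"
    unfolding locally_equal_def by blast
  obtain \<eta> where l: "\<eta> \<in> mor_to E (src E \<nu>)" "x \<in> Z (\<nu> \<cdot> \<eta>)" "Z (\<nu> \<cdot> \<eta>) \<subseteq> Z \<kappa>"
    using Z_refine[OF spanD(2)[OF s(1)] k(1) x k(2)] by blast
  have "germ E B F \<mu> \<nu> y \<in> germ_cyl E B F \<mu>' \<nu>'" if "y \<in> Z (\<nu> \<cdot> \<eta>)" for y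
  proof -
    have y: "y \<in> Z \<kappa>" "y \<in> Z \<nu>" "y \<in> Z \<nu>'" using that l(3) k(3) by auto
    then have "locally_equal \<mu> \<nu> \<mu>' \<nu>' y" unfolding locally_equal_def using k by blast
    then have "germ E B F \<mu> \<nu> y = germ E B F \<mu>' \<nu>' y"
      using germ_eq_iff[OF s(1) y(2) s(2) y(3)] eq(3) by simp
    then show ?thesis unfolding germ_cyl_def using y(3) by blast
  qed
  then show thesis using that l by blast
qed

section \<open>The topology of the germ groupoid\<close>

abbreviation G where "G \<equiv> germ_topology E B F"

text \<open>
  What has to be checked is that the sets \<open>Z(\<mu>, \<nu>)\<close> form a basis: around a point of an intersection
  of two of them, \<open>germ_neighbourhood\<close> provides a basic set \<open>Z(\<mu>\<eta>, \<nu>\<eta>)\<close> inside both.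
\<close>

lemma openin_germ_topology:
  "openin G U \<longleftrightarrow> (\<forall>g\<in>U. \<exists>\<mu> \<nu>. spans \<mu> \<nu> \<and> g \<in> germ_cyl E B F \<mu> \<nu> \<and> germ_cyl E B F \<mu> \<nu> \<subseteq> U)"
proof -
  let ?P = "\<lambda>U. \<exists>\<mu> \<nu>. spans \<mu> \<nu> \<and> U = germ_cyl E B F \<mu> \<nu>"
  have "(arbitrary union_of ?P) (S \<inter> T)" if ST: "?P S" "?P T" for S T
    unfolding arbitrary_union_of_alt
  proof
    fix g assume g: "g \<in> S \<inter> T"
    obtain \<mu> \<nu> \<mu>' \<nu>' where s: "spans \<mu> \<nu>" "S = germ_cyl E B F \<mu> \<nu>" "spans \<mu>' \<nu>'" "T = germ_cyl E B F \<mu>' \<nu>'"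
      using ST by blast
    obtain x where x: "x \<in> Z \<nu>" "g = germ E B F \<mu> \<nu> x" using g s unfolding germ_cyl_def by blast
    obtain \<eta> where l: "\<eta> \<in> mor_to E (src E \<nu>)" "x \<in> Z (\<nu> \<cdot> \<eta>)"
      "germ E B F \<mu> \<nu> ` Z (\<nu> \<cdot> \<eta>) \<subseteq> T"
      using germ_neighbourhood[OF s(1,3) x(1)] g x s by (metis IntD2)
    have "germ E B F \<mu> \<nu> ` Z (\<nu> \<cdot> \<eta>) \<subseteq> S"
      unfolding s(2) germ_cyl_def using Z_comp_subset[OF spanD(2)[OF s(1)] l(1)] by blast
    then show "\<exists>U. ?P U \<and> g \<in> U \<and> U \<subseteq> S \<inter> T"
      using l x(2) germ_cyl_extend[OF s(1) l(1)] span_comp[OF s(1) l(1)]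
      by (intro exI[of _ "germ E B F \<mu> \<nu> ` Z (\<nu> \<cdot> \<eta>)"]) blast
  qed
  then have "istopology (arbitrary union_of ?P)"
    unfolding istopology_base_eq by blast
  then have "openin G = arbitrary union_of ?P"
    unfolding germ_topology_def by (simp add: topology_inverse')
  then have "openin G U \<longleftrightarrow> (\<forall>g\<in>U. \<exists>V. ?P V \<and> g \<in> V \<and> V \<subseteq> U)"
    by (simp add: arbitrary_union_of_alt)
  then show ?thesis by blast
qed

lemma openin_germ_cyl: "spans \<mu> \<nu> \<Longrightarrow> openin G (germ_cyl E B F \<mu> \<nu>)"
  unfolding openin_germ_topology by blast

lemma topspace_germ_topology: "topspace G = germs E B F"
proof -
  have "topspace G = \<Union> {germ_cyl E B F \<mu> \<nu> |\<mu> \<nu>. spans \<mu> \<nu>}"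
  proof
    show "topspace G \<subseteq> \<Union> {germ_cyl E B F \<mu> \<nu> |\<mu> \<nu>. spans \<mu> \<nu>}"
      using openin_topspace[of G] unfolding openin_germ_topology by blast
    show "\<Union> {germ_cyl E B F \<mu> \<nu> |\<mu> \<nu>. spans \<mu> \<nu>} \<subseteq> topspace G"
      using openin_germ_cyl openin_subset by blast
  qed
  then show ?thesis using Union_germ_cyl[OF E.category] by simp
qed

lemma germs_cases:
  assumes "g \<in> germs E B F"
  obtains \<mu> \<nu> x where "spans \<mu> \<nu>" "x \<in> Z \<nu>" "g = germ E B F \<mu> \<nu> x"
proof -
  have "g \<in> \<Union> {germ_cyl E B F \<mu> \<nu> |\<mu> \<nu>. spans \<mu> \<nu>}"
    unfolding Union_germ_cyl[OF E.category] by (rule assms)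
  then show thesis using that unfolding germ_cyl_def by blast
qed

lemma separate_paths:
  assumes \<nu>: "\<nu> \<in> Mor E" "\<nu>' \<in> Mor E" and x: "x \<in> Z \<nu>" "x' \<in> Z \<nu>'" and neq: "x \<noteq> x'"
  obtains \<kappa> \<kappa>' where "\<kappa> \<in> Mor E" "\<kappa>' \<in> Mor E" "x \<in> Z \<kappa>" "x' \<in> Z \<kappa>'" "Z \<kappa> \<inter> Z \<kappa>' = {}"
proof (cases "rng E \<nu> = rng E \<nu>'")
  case False
  have "Z \<nu> \<inter> Z \<nu>' = {}"
    using False fst_path cylD(1) by (metis disjoint_iff)
  then show thesis using that \<nu> x by blast
next
  case True
  have p: "x \<in> paths (rng E \<nu>)" "x' \<in> paths (rng E \<nu>)" using cylD(1)[OF x(1)] cylD(1)[OF x(2)] True by simp_all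
  then obtain a where a: "a \<in> mor_to B (F (rng E \<nu>))" "val x a \<noteq> val x' a"
    using path_eqI neq by blast
  note v = path_at[OF p(1) a(1)] path_at[OF p(2) a(1)]
  have r: "rng E (val x a) = rng E \<nu>" "rng E (val x' a) = rng E \<nu>" using v by auto
  have "x \<in> Z (val x a)" "x' \<in> Z (val x' a)" unfolding cyl_def using p v r by simp_all
  moreover have "Z (val x a) \<inter> Z (val x' a) = {}"
    using cylD(2)[of _ "val x a"] cylD(2)[of _ "val x' a"] v a(2) by (metis disjoint_iff)
  ultimately show thesis using that v by blast
qed

text \<open>
  The core of the Hausdorff property.  For germs over the same path, either \<open>same_degree\<close> fails and
  no germs of the two basic sets can coincide, or both germs can be prolonged along \<open>x\<close> to have the
  same second component and first components of the same degree.
\<close>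

lemma separate_germs:
  assumes "g \<in> germs E B F" "g' \<in> germs E B F" "g \<noteq> g'"
  obtains \<mu> \<nu> \<mu>' \<nu>' where "spans \<mu> \<nu>" "spans \<mu>' \<nu>'"
    "g \<in> germ_cyl E B F \<mu> \<nu>" "g' \<in> germ_cyl E B F \<mu>' \<nu>'"
    "germ_cyl E B F \<mu> \<nu> \<inter> germ_cyl E B F \<mu>' \<nu>' = {}"
proof -
  obtain \<mu> \<nu> x where g: "spans \<mu> \<nu>" "x \<in> Z \<nu>" "g = germ E B F \<mu> \<nu> x"
    using germs_cases[OF assms(1)] .
  obtain \<mu>' \<nu>' x' where g': "spans \<mu>' \<nu>'" "x' \<in> Z \<nu>'" "g' = germ E B F \<mu>' \<nu>' x'"
    using germs_cases[OF assms(2)] .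
  note S = spanD[OF g(1)] and S' = spanD[OF g'(1)]
  consider "x \<noteq> x'" | "x = x'" "\<not> same_degree \<mu> \<nu> \<mu>' \<nu>'" | "x = x'" "same_degree \<mu> \<nu> \<mu>' \<nu>'" by blast
  then show thesis
  proof cases
    case 1
    obtain \<kappa> \<kappa>' where k: "\<kappa> \<in> Mor E" "\<kappa>' \<in> Mor E" "x \<in> Z \<kappa>" "x' \<in> Z \<kappa>'" "Z \<kappa> \<inter> Z \<kappa>' = {}"
      using separate_paths[OF S(2) S'(2) g(2) g'(2) 1] .
    obtain \<eta> where l: "\<eta> \<in> mor_to E (src E \<nu>)" "x \<in> Z (\<nu> \<cdot> \<eta>)" "Z (\<nu> \<cdot> \<eta>) \<subseteq> Z \<kappa>"
      using Z_refine[OF S(2) k(1) g(2) k(3)] .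
    obtain \<eta>' where l': "\<eta>' \<in> mor_to E (src E \<nu>')" "x' \<in> Z (\<nu>' \<cdot> \<eta>')" "Z (\<nu>' \<cdot> \<eta>') \<subseteq> Z \<kappa>'"
      using Z_refine[OF S'(2) k(2) g'(2) k(4)] .
    have sub: "Z (\<nu> \<cdot> \<eta>) \<subseteq> Z \<nu>" "Z (\<nu>' \<cdot> \<eta>') \<subseteq> Z \<nu>'"
      using Z_comp_subset S(2) S'(2) l(1) l'(1) by blast+
    have "germ E B F \<mu> \<nu> y \<noteq> germ E B F \<mu>' \<nu>' y'" if "y \<in> Z (\<nu> \<cdot> \<eta>)" "y' \<in> Z (\<nu>' \<cdot> \<eta>')" for y y'
    proof -
      have "y \<noteq> y'" "y \<in> Z \<nu>" "y' \<in> Z \<nu>'" using that l(3) l'(3) k(5) sub by blast+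
      then show ?thesis using germ_eq_iff[OF g(1) _ g'(1)] by simp
    qed
    then have "germ E B F \<mu> \<nu> ` Z (\<nu> \<cdot> \<eta>) \<inter> germ E B F \<mu>' \<nu>' ` Z (\<nu>' \<cdot> \<eta>') = {}" by blast
    moreover have "g \<in> germ E B F \<mu> \<nu> ` Z (\<nu> \<cdot> \<eta>)" "g' \<in> germ E B F \<mu>' \<nu>' ` Z (\<nu>' \<cdot> \<eta>')"
      using g(3) g'(3) l(2) l'(2) by blast+
    ultimately show thesis
      using that[OF span_comp[OF g(1) l(1)] span_comp[OF g'(1) l'(1)]]
        germ_cyl_extend[OF g(1) l(1)] germ_cyl_extend[OF g'(1) l'(1)] by simp
  next
    case 2
    have "germ E B F \<mu> \<nu> y \<noteq> germ E B F \<mu>' \<nu>' y'" if "y \<in> Z \<nu>" "y' \<in> Z \<nu>'" for y y'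
      using germ_eq_iff[OF g(1) that(1) g'(1) that(2)] 2(2) by simp
    then have "germ_cyl E B F \<mu> \<nu> \<inter> germ_cyl E B F \<mu>' \<nu>' = {}" unfolding germ_cyl_def by blast
    moreover have "g \<in> germ_cyl E B F \<mu> \<nu>" "g' \<in> germ_cyl E B F \<mu>' \<nu>'"
      using g g' unfolding germ_cyl_def by blast+
    ultimately show thesis using that g(1) g'(1) by blast
  next
    case 3
    obtain a b where ab: "a \<in> mor_to B (src B (F \<nu>))" "b \<in> mor_to B (src B (F \<nu>'))"
      "F \<mu> \<odot> a = F \<mu>' \<odot> b" "F \<nu> \<odot> a = F \<nu>' \<odot> b"
      using 3(2) S(4) S'(4) unfolding same_degree_def by auto
    \<comment> \<open>Prolonging along \<open>x\<close> gives \<open>\<nu>\<eta> = x(F(\<nu>)a) = x(F(\<nu>')b) = \<nu>'\<eta>'\<close>.\<close>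
    obtain \<eta> where l: "\<eta> \<in> mor_to E (src E \<nu>)" "F \<eta> = a" "x \<in> Z (\<nu> \<cdot> \<eta>)"
      using Z_extend[OF S(2) g(2) ab(1)] .
    obtain \<eta>' where l': "\<eta>' \<in> mor_to E (src E \<nu>')" "F \<eta>' = b" "x \<in> Z (\<nu>' \<cdot> \<eta>')"
      using Z_extend[OF S'(2) g'(2) ab(2)] 3(1) by metis
    have F_eq: "F (\<nu> \<cdot> \<eta>) = F (\<nu>' \<cdot> \<eta>')" "F (\<mu> \<cdot> \<eta>) = F (\<mu>' \<cdot> \<eta>')"
      using F_comp[OF S(2) l(1)] F_comp[OF S'(2) l'(1)] F_comp[OF S(1), of \<eta>] F_comp[OF S'(1), of \<eta>']
        l(1,2) l'(1,2) ab(3,4) by (simp_all add: S(3) S'(3))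
    then have \<nu>_eq: "\<nu> \<cdot> \<eta> = \<nu>' \<cdot> \<eta>'" using cylD(2)[OF l(3)] cylD(2)[OF l'(3)] by metis
    note sp = span_comp[OF g(1) l(1)] span_comp[OF g'(1) l'(1)]
    have gx: "g = germ E B F (\<mu> \<cdot> \<eta>) (\<nu> \<cdot> \<eta>) x" "g' = germ E B F (\<mu>' \<cdot> \<eta>') (\<nu>' \<cdot> \<eta>') x"
      using germ_extend[OF g(1) l(1,3)] germ_extend[OF g'(1) l'(1,3)] g(3) g'(3) 3(1) by simp_all
    then have neq: "\<mu> \<cdot> \<eta> \<noteq> \<mu>' \<cdot> \<eta>'" using assms(3) \<nu>_eq by auto
    have "germ E B F (\<mu> \<cdot> \<eta>) (\<nu> \<cdot> \<eta>) y \<noteq> germ E B F (\<mu>' \<cdot> \<eta>') (\<nu>' \<cdot> \<eta>') y'"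
      if y: "y \<in> Z (\<nu> \<cdot> \<eta>)" "y' \<in> Z (\<nu>' \<cdot> \<eta>')" for y y'
    proof
      assume "germ E B F (\<mu> \<cdot> \<eta>) (\<nu> \<cdot> \<eta>) y = germ E B F (\<mu>' \<cdot> \<eta>') (\<nu>' \<cdot> \<eta>') y'"
      then have "locally_equal (\<mu> \<cdot> \<eta>) (\<nu> \<cdot> \<eta>) (\<mu>' \<cdot> \<eta>') (\<nu>' \<cdot> \<eta>') y"
        using germ_eq_iff[OF sp(1) y(1) sp(2) y(2)] by blast
      then have "ind E B F (\<mu> \<cdot> \<eta>) (res E B F (\<nu> \<cdot> \<eta>) y) = ind E B F (\<mu>' \<cdot> \<eta>') (res E B F (\<nu> \<cdot> \<eta>) y)"
        unfolding locally_equal_def \<nu>_eq by blast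
      moreover have "res E B F (\<nu> \<cdot> \<eta>) y \<in> paths (src E (\<nu> \<cdot> \<eta>))"
        using res_in_paths spanD(2)[OF sp(1)] y(1) .
      \<comment> \<open>A common value lies in both \<open>Z(\<mu>\<eta>)\<close> and \<open>Z(\<mu>'\<eta>')\<close>, but a path has only one value over \<open>F(\<mu>\<eta>) = F(\<mu>'\<eta>')\<close>.\<close>
      ultimately have "ind E B F (\<mu> \<cdot> \<eta>) (res E B F (\<nu> \<cdot> \<eta>) y) \<in> Z (\<mu> \<cdot> \<eta>) \<inter> Z (\<mu>' \<cdot> \<eta>')"
        using ind(1)[OF spanD(1)[OF sp(1)]] ind(1)[OF spanD(1)[OF sp(2)]]
          spanD(3)[OF sp(1)] spanD(3)[OF sp(2)] \<nu>_eq by (metis IntI)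
      then show False using cylD(2) F_eq(2) neq by (metis IntD1 IntD2)
    qed
    then have "germ_cyl E B F (\<mu> \<cdot> \<eta>) (\<nu> \<cdot> \<eta>) \<inter> germ_cyl E B F (\<mu>' \<cdot> \<eta>') (\<nu>' \<cdot> \<eta>') = {}"
      unfolding germ_cyl_def by blast
    moreover have "g \<in> germ_cyl E B F (\<mu> \<cdot> \<eta>) (\<nu> \<cdot> \<eta>)" "g' \<in> germ_cyl E B F (\<mu>' \<cdot> \<eta>') (\<nu>' \<cdot> \<eta>')"
      using gx l(3) l'(3) unfolding germ_cyl_def by blast+
    ultimately show thesis using that sp by blast
  qed
qed

lemma Hausdorff_germ_topology: "Hausdorff_space G"
  unfolding Hausdorff_space_def topspace_germ_topology
proof (intro allI impI)
  fix g g' assume "g \<in> germs E B F \<and> g' \<in> germs E B F \<and> g \<noteq> g'"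
  then show "\<exists>U V. openin G U \<and> openin G V \<and> g \<in> U \<and> g' \<in> V \<and> disjnt U V"
    using separate_germs[of g g'] openin_germ_cyl unfolding disjnt_def by metis
qed

section \<open>Compactness of the basic open sets\<close>

text \<open>
  All choices of lifts, coherent or not, as a product of discrete spaces.
\<close>

definition lift_space :: "'e \<Rightarrow> ('b \<Rightarrow> 'e) topology" where
  "lift_space X = product_topology (\<lambda>a. discrete_topology {\<alpha> \<in> mor_to E X. F \<alpha> = a}) (mor_to B (F X))"

lemma topspace_lift_space:
  "topspace (lift_space X) = (\<Pi>\<^sub>E a\<in>mor_to B (F X). {\<alpha> \<in> mor_to E X. F \<alpha> = a})"
  unfolding lift_space_def by simp

lemma lift_spaceD:
  assumes "f \<in> topspace (lift_space X)" "a \<in> mor_to B (F X)"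
  shows "f a \<in> mor_to E X" "F (f a) = a"
  using assms unfolding topspace_lift_space by (auto dest: PiE_mem)

lemma openin_coordinate:
  assumes a: "a \<in> mor_to B (F X)"
  shows "openin (lift_space X) {f \<in> topspace (lift_space X). f a = \<alpha>}"
proof -
  let ?A = "{\<alpha> \<in> mor_to E X. F \<alpha> = a}"
  have "continuous_map (lift_space X) (discrete_topology ?A) (\<lambda>f. f a)"
    unfolding lift_space_def by (rule continuous_map_product_projection[OF a])
  then have "openin (lift_space X) {f \<in> topspace (lift_space X). f a \<in> {\<alpha>} \<inter> ?A}"
    by (rule openin_continuous_map_preimage) simp
  moreover have "{f \<in> topspace (lift_space X). f a \<in> {\<alpha>} \<inter> ?A} = {f \<in> topspace (lift_space X). f a = \<alpha>}"
    using lift_spaceD[OF _ a] by blast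
  ultimately show ?thesis by simp
qed

text \<open>
  An instance of incoherence is visible in the two coordinates \<open>a\<close> and \<open>ab\<close>, so it persists in an open
  set.
\<close>

lemma closedin_threads: "closedin (lift_space X) {f \<in> topspace (lift_space X). thread X f}"
  unfolding closedin_def
proof
  show "openin (lift_space X) (topspace (lift_space X) - {f \<in> topspace (lift_space X). thread X f})"
  proof (subst openin_subopen, intro ballI)
    fix f assume f: "f \<in> topspace (lift_space X) - {f \<in> topspace (lift_space X). thread X f}"
    then have fX: "f \<in> topspace (lift_space X)" and nt: "\<not> thread X f" by auto
    obtain a b where ab: "a \<in> mor_to B (F X)" "b \<in> mor_to B (src B a)"
      "\<not> (\<exists>\<gamma>\<in>mor_to E (src E (f a)). F \<gamma> = b \<and> f (a \<odot> b) = f a \<cdot> \<gamma>)"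
      using nt lift_spaceD[OF fX] unfolding thread_def by blast
    let ?U = "{h \<in> topspace (lift_space X). h a = f a} \<inter> {h \<in> topspace (lift_space X). h (a \<odot> b) = f (a \<odot> b)}"
    have "openin (lift_space X) ?U"
      using openin_coordinate ab(1,2) by (intro openin_Int) simp_all
    moreover have "\<not> thread X h" if "h \<in> ?U" for h
    proof
      assume "thread X h"
      then have "\<exists>\<gamma>\<in>mor_to E (src E (h a)). F \<gamma> = b \<and> h (a \<odot> b) = h a \<cdot> \<gamma>"
        using ab(1,2) unfolding thread_def by blast
      moreover have "h a = f a" "h (a \<odot> b) = f (a \<odot> b)" using that by auto
      ultimately show False using ab(3) by simp
    qed
    ultimately show "\<exists>T. openin (lift_space X) T \<and> f \<in> T \<and>
        T \<subseteq> topspace (lift_space X) - {f \<in> topspace (lift_space X). thread X f}"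
      using fX by (intro exI[of _ ?U]) blast
  qed
qed blast

text \<open>
  Row-finiteness makes the discrete factors finite, hence the product compact by Tychonoff's
  theorem.
\<close>

lemma compactin_threads_through:
  assumes rf: "row_finite E B F" and \<nu>: "\<nu> \<in> Mor E"
  shows "compactin (lift_space (rng E \<nu>))
    {f \<in> topspace (lift_space (rng E \<nu>)). thread (rng E \<nu>) f \<and> f (F \<nu>) = \<nu>}"
proof -
  let ?X = "rng E \<nu>"
  have fin: "finite {\<alpha> \<in> mor_to E ?X. F \<alpha> = a}" if "a \<in> mor_to B (F ?X)" for a
    using rf that E.rng_Ob[OF \<nu>] unfolding row_finite_def by blast
  have "compact_space (lift_space ?X)"
    unfolding lift_space_def compact_space_product_topology
    using fin by (simp add: compact_space_discrete_topology)
  moreover have "closedin (lift_space ?X) {f \<in> topspace (lift_space ?X). f (F \<nu>) = \<nu>}"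
  proof -
    have "F \<nu> \<in> mor_to B (F ?X)" using \<nu> by simp
    then have "continuous_map (lift_space ?X) (discrete_topology {\<alpha> \<in> mor_to E ?X. F \<alpha> = F \<nu>}) (\<lambda>f. f (F \<nu>))"
      unfolding lift_space_def by (rule continuous_map_product_projection)
    then have "closedin (lift_space ?X) {f \<in> topspace (lift_space ?X). f (F \<nu>) \<in> {\<nu>}}"
      by (rule closedin_continuous_map_preimage) (simp add: \<nu>)
    then show ?thesis by simp
  qed
  ultimately have "compactin (lift_space ?X) ({f \<in> topspace (lift_space ?X). thread ?X f} \<inter>
      {f \<in> topspace (lift_space ?X). f (F \<nu>) = \<nu>})"
    using closedin_threads closedin_compact_space by blast
  moreover have "{f \<in> topspace (lift_space ?X). thread ?X f} \<inter> {f \<in> topspace (lift_space ?X). f (F \<nu>) = \<nu>}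
    = {f \<in> topspace (lift_space ?X). thread ?X f \<and> f (F \<nu>) = \<nu>}" by blast
  ultimately show ?thesis by simp
qed

lemma path_of_in_Z_iff:
  assumes \<nu>: "\<nu> \<in> Mor E" and f: "thread (rng E \<nu>) f"
  shows "path_of (rng E \<nu>) f \<in> Z \<nu> \<longleftrightarrow> f (F \<nu>) = \<nu>"
proof -
  have "F \<nu> \<in> mor_to B (F (rng E \<nu>))" using \<nu> by simp
  then show ?thesis
    unfolding cyl_def using path_of_in_paths[OF E.rng_Ob[OF \<nu>] f] at_path_of by simp
qed

lemma path_of_restrict_val:
  assumes x: "x \<in> paths X" and X: "X \<in> Ob E"
  defines "f \<equiv> restrict (val x) (mor_to B (F X))"
  shows "f \<in> topspace (lift_space X)" "thread X f" "path_of X f = x"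
proof -
  show "f \<in> topspace (lift_space X)"
    unfolding topspace_lift_space f_def using path_at[OF x] by auto
  have "f a = val x a" if "a \<in> mor_to B (F X)" for a unfolding f_def using that by simp
  then show t: "thread X f"
    using thread_at[OF x] unfolding thread_def by simp
  show "path_of X f = x"
    using at_path_of[of _ X f] unfolding f_def
    by (intro path_eqI[OF path_of_in_paths[OF X t[unfolded f_def]] x]) simp
qed

text \<open>
  The basic set is the image of the compact set of threads through \<open>\<nu>\<close>.  The map is continuous
  because, by \<open>germ_neighbourhood\<close>, membership of the germ in a basic set is guaranteed by a single
  coordinate of the thread, the one at \<open>F(\<nu>\<eta>)\<close>.
\<close>

lemma compactin_germ_cyl:
  assumes rf: "row_finite E B F" and s: "spans \<mu> \<nu>"
  shows "compactin G (germ_cyl E B F \<mu> \<nu>)"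
proof -
  note S = spanD[OF s]
  let ?X = "rng E \<nu>"
  let ?L = "lift_space ?X"
  define T where "T = {f \<in> topspace ?L. thread ?X f \<and> f (F \<nu>) = \<nu>}"
  define \<Phi> where "\<Phi> f = germ E B F \<mu> \<nu> (path_of ?X f)" for f
  have T: "f \<in> topspace ?L" "thread ?X f" "path_of ?X f \<in> Z \<nu>" if "f \<in> T" for f
    using that path_of_in_Z_iff[OF S(2)] unfolding T_def by auto
  have image: "\<Phi> ` T = germ_cyl E B F \<mu> \<nu>"
  proof
    show "\<Phi> ` T \<subseteq> germ_cyl E B F \<mu> \<nu>" unfolding \<Phi>_def germ_cyl_def using T(3) by blast
    show "germ_cyl E B F \<mu> \<nu> \<subseteq> \<Phi> ` T"
    proof
      fix g assume "g \<in> germ_cyl E B F \<mu> \<nu>"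
      then obtain x where x: "x \<in> Z \<nu>" "g = germ E B F \<mu> \<nu> x" unfolding germ_cyl_def by blast
      define f where "f = restrict (val x) (mor_to B (F ?X))"
      have f: "f \<in> topspace ?L" "thread ?X f" "path_of ?X f = x"
        using path_of_restrict_val[OF cylD(1)[OF x(1)] E.rng_Ob[OF S(2)]] unfolding f_def by blast+
      then have "f \<in> T" unfolding T_def using path_of_in_Z_iff[OF S(2) f(2)] x(1) by simp
      then show "g \<in> \<Phi> ` T" using x(2) f(3) unfolding \<Phi>_def by blast
    qed
  qed
  have topT: "topspace (subtopology ?L T) = T" unfolding T_def by auto
  have "continuous_map (subtopology ?L T) G \<Phi>"
    unfolding continuous_map_def topT
  proof (intro conjI allI impI)
    show "\<Phi> \<in> T \<rightarrow> topspace G"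
      using image openin_subset[OF openin_germ_cyl[OF s]] by blast
    fix U assume U: "openin G U"
    show "openin (subtopology ?L T) {f \<in> T. \<Phi> f \<in> U}"
    proof (subst openin_subopen, intro ballI)
      fix f assume f: "f \<in> {f \<in> T. \<Phi> f \<in> U}"
      then obtain \<mu>' \<nu>' where s': "spans \<mu>' \<nu>'" "\<Phi> f \<in> germ_cyl E B F \<mu>' \<nu>'" "germ_cyl E B F \<mu>' \<nu>' \<subseteq> U"
        using U unfolding openin_germ_topology by blast
      have pf: "path_of ?X f \<in> Z \<nu>" using T(3) f by blast
      obtain \<eta> where l: "\<eta> \<in> mor_to E (src E \<nu>)" "path_of ?X f \<in> Z (\<nu> \<cdot> \<eta>)"
        "germ E B F \<mu> \<nu> ` Z (\<nu> \<cdot> \<eta>) \<subseteq> germ_cyl E B F \<mu>' \<nu>'"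
        using germ_neighbourhood[OF s s'(1) pf s'(2)[unfolded \<Phi>_def]] .
      have m: "\<nu> \<cdot> \<eta> \<in> Mor E" "rng E (\<nu> \<cdot> \<eta>) = ?X" "F (\<nu> \<cdot> \<eta>) \<in> mor_to B (F ?X)"
        using S(2) l(1) F_mor_to[of "\<nu> \<cdot> \<eta>" ?X] by simp_all
      have iff: "path_of ?X h \<in> Z (\<nu> \<cdot> \<eta>) \<longleftrightarrow> h (F (\<nu> \<cdot> \<eta>)) = \<nu> \<cdot> \<eta>" if "h \<in> T" for h
        using path_of_in_Z_iff[OF m(1)] T(2)[OF that] m(2) by simp
      let ?V = "T \<inter> {h \<in> topspace ?L. h (F (\<nu> \<cdot> \<eta>)) = \<nu> \<cdot> \<eta>}"
      have "openin (subtopology ?L T) ?V"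
        using openin_coordinate[OF m(3)] by (rule openin_subtopology_Int2)
      moreover have "f \<in> ?V" using f iff l(2) T(1) by blast
      moreover have "?V \<subseteq> {f \<in> T. \<Phi> f \<in> U}"
        using iff l(3) s'(3) unfolding \<Phi>_def by blast
      ultimately show "\<exists>V. openin (subtopology ?L T) V \<and> f \<in> V \<and> V \<subseteq> {f \<in> T. \<Phi> f \<in> U}" by blast
    qed
  qed
  moreover have "compactin (subtopology ?L T) T"
    using compactin_threads_through[OF rf S(2)] unfolding T_def compactin_subtopology by blast
  ultimately show ?thesis using image_compactin image by metis
qed

lemma locally_compact_germ_topology:
  assumes "row_finite E B F"
  shows "locally_compact_space G"
  unfolding locally_compact_space_def topspace_germ_topology
proof
  fix g assume "g \<in> germs E B F"
  then obtain \<mu> \<nu> x where g: "spans \<mu> \<nu>" "x \<in> Z \<nu>" "g = germ E B F \<mu> \<nu> x"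
    by (rule germs_cases)
  then have "g \<in> germ_cyl E B F \<mu> \<nu>" unfolding germ_cyl_def by blast
  then show "\<exists>U K. openin G U \<and> compactin G K \<and> g \<in> U \<and> U \<subseteq> K"
    using openin_germ_cyl[OF g(1)] compactin_germ_cyl[OF assms g(1)] by blast
qed

text \<open>
  Basic sets are open, and closed because they are compact in a Hausdorff space; as they separate
  points, a connected set has at most one.
\<close>

lemma totally_disconnected_germ_topology:
  assumes "row_finite E B F"
  shows "totally_disconnected_space G"
  unfolding totally_disconnected_space_def
proof (intro allI impI)
  fix S assume S: "connectedin G S"
  have "g = g'" if g: "g \<in> S" "g' \<in> S" for g g'
  proof (rule ccontr)
    assume neq: "g \<noteq> g'"
    have "g \<in> germs E B F" "g' \<in> germs E B F"
      using g connectedin_subset_topspace[OF S] topspace_germ_topology by auto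
    then obtain \<mu> \<nu> \<mu>' \<nu>' where s: "spans \<mu> \<nu>" "g \<in> germ_cyl E B F \<mu> \<nu>"
      "g' \<in> germ_cyl E B F \<mu>' \<nu>'" "germ_cyl E B F \<mu> \<nu> \<inter> germ_cyl E B F \<mu>' \<nu>' = {}"
      using separate_germs[OF _ _ neq] by metis
    have "closedin G (germ_cyl E B F \<mu> \<nu>)"
      using compactin_imp_closedin[OF Hausdorff_germ_topology compactin_germ_cyl[OF assms s(1)]] .
    from connectedin_clopen_cases[OF S this openin_germ_cyl[OF s(1)]]
    show False using g s(2-4) unfolding disjnt_def by blast
  qed
  then show "\<exists>a. S \<subseteq> {a}" by blast
qed

end

theorem theorem4p16:
  fixes E :: "'e cat" and B :: "'b cat" and F :: "'e \<Rightarrow> 'b"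
  assumes "Kumjian_Pask_fibration E B F"
    and "row_finite E B F"
    and "\<forall>X\<in>Ob B. countable (Mor (slice B X))"
  shows "topspace (germ_topology E B F) = germs E B F \<and>
    totally_disconnected_space (germ_topology E B F) \<and>
    locally_compact_space (germ_topology E B F) \<and>
    Hausdorff_space (germ_topology E B F)"
proof -
  interpret conduche_ore E B F
    using assms(1) unfolding Kumjian_Pask_fibration_def by unfold_locales simp_all
  show ?thesis
    using topspace_germ_topology totally_disconnected_germ_topology[OF assms(2)]
      locally_compact_germ_topology[OF assms(2)] Hausdorff_germ_topology by blast
qed

end
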